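(* Let $H=(H_t)_{t\ge0}$ and $J=(J_t)_{t\ge0}$ be progressively measurable processes on $(\Omega,(\mathcal F_t)_{t\ge0},\mathcal F,\mathsf P)$ with $\mathsf E\int_0^t(H_s^2+J_s^2)\,\mathrm ds<\infty$ for all $t>0$. Let $x,y\in\mathbb R$ and, for $V\in\mathcal V$, let $$X_t=x+\int_0^tH_s\,\mathrm dB_s,\qquad Y_t(V)=y+\int_0^tJ_s\,\mathrm dV_s,\qquad t\ge0.$$ Let $V^I_t=\int_0^t\operatorname{sgn}(H_sJ_s)\,\mathrm dB_s$ and $V^{II}_t=-V^I_t$, and let $T>0$. Then, for every $V\in\mathcal V$, $$\mathsf E\left[(X_T-Y_T(V^{I}))^2\right]\le\mathsf E\left[(X_T-Y_T(V))^2\right]\le\mathsf E\left[(X_T-Y_T(V^{II}))^2\right].$$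
   Context: $(\Omega,(\mathcal F_t)_{t\ge0},\mathcal F,\mathsf P)$ is a filtered probability space supporting a standard $(\mathcal F_t)$-Brownian motion $B$; $\mathcal V$ is the set of all $(\mathcal F_t)$-Brownian motions $V=(V_t)_{t\ge0}$ on this space with $V_0=0$. $\operatorname{sgn}(x)=1$ if $x>0$, $\operatorname{sgn}(x)=-1$ if $x<0$, and $\operatorname{sgn}(0)\in\{1,-1\}$ is an arbitrary fixed choice. No Markov assumption is made on $H$ and $J$. *)

theory Defs
  imports "HOL-Probability.Probability"
begin

text \<open>Processes are functions of type \<^typ>\<open>real \<Rightarrow> 'a \<Rightarrow> real\<close>; only their values at times \<open>t \<ge> 0\<close>
  matter. The library locale \<^locale>\<open>filtration\<close> would index the filtration by all of \<^typ>\<open>real\<close>,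
  whereas here only the \<open>F t\<close> with \<open>t \<ge> 0\<close> are constrained. Neither completeness nor
  right-continuity of the filtration is assumed.\<close>

locale filtered_prob_space = prob_space M
  for M :: "'a measure" and F :: "real \<Rightarrow> 'a measure" +
  assumes subalgebra_filtration: "\<And>t. 0 \<le> t \<Longrightarrow> subalgebra M (F t)"
    and filtration_mono: "\<And>s t. 0 \<le> s \<Longrightarrow> s \<le> t \<Longrightarrow> subalgebra (F t) (F s)"

definition adapted :: "(real \<Rightarrow> 'a measure) \<Rightarrow> (real \<Rightarrow> 'a \<Rightarrow> real) \<Rightarrow> bool" where
  "adapted F X \<longleftrightarrow> (\<forall>t\<ge>0. X t \<in> borel_measurable (F t))"

definition progressively_measurable ::
    "(real \<Rightarrow> 'a measure) \<Rightarrow> (real \<Rightarrow> 'a \<Rightarrow> real) \<Rightarrow> bool" where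
  "progressively_measurable F H \<longleftrightarrow>
     (\<forall>t\<ge>0. (\<lambda>(s, \<omega>). H s \<omega>) \<in> borel_measurable (restrict_space borel {0..t} \<Otimes>\<^sub>M F t))"

definition continuous_paths :: "'a measure \<Rightarrow> (real \<Rightarrow> 'a \<Rightarrow> real) \<Rightarrow> bool" where
  "continuous_paths M X \<longleftrightarrow> (AE \<omega> in M. continuous_on {0..} (\<lambda>t. X t \<omega>))"

text \<open>Path properties are required almost surely, which makes it possible to stay adapted to a
  filtration that need not contain the null sets.\<close>

definition brownian_motions ::
    "'a measure \<Rightarrow> (real \<Rightarrow> 'a measure) \<Rightarrow> (real \<Rightarrow> 'a \<Rightarrow> real) set" where
  "brownian_motions M F = {V.
     adapted F V \<and> continuous_paths M V \<and> (AE \<omega> in M. V 0 \<omega> = 0) \<and>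
     (\<forall>s t. 0 \<le> s \<longrightarrow> s < t \<longrightarrow>
        distributed M lborel (\<lambda>\<omega>. V t \<omega> - V s \<omega>) (normal_density 0 (sqrt (t - s))) \<and>
        prob_space.indep_set M (sets (F s))
          (sets (vimage_algebra (space M) (\<lambda>\<omega>. V t \<omega> - V s \<omega>) borel)))}"

definition elementary_integrand ::
    "'a measure \<Rightarrow> (real \<Rightarrow> 'a measure) \<Rightarrow> nat \<Rightarrow> (nat \<Rightarrow> real) \<Rightarrow> (nat \<Rightarrow> 'a \<Rightarrow> real) \<Rightarrow> bool" where
  "elementary_integrand M F n \<tau> \<xi> \<longleftrightarrow>
     0 \<le> \<tau> 0 \<and>
     (\<forall>i<n. \<tau> i \<le> \<tau> (Suc i) \<and> \<xi> i \<in> borel_measurable (F (\<tau> i)) \<and>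
        (\<exists>C. \<forall>\<omega>\<in>space M. \<bar>\<xi> i \<omega>\<bar> \<le> C))"

definition elementary_process ::
    "nat \<Rightarrow> (nat \<Rightarrow> real) \<Rightarrow> (nat \<Rightarrow> 'a \<Rightarrow> real) \<Rightarrow> real \<Rightarrow> 'a \<Rightarrow> real" where
  "elementary_process n \<tau> \<xi> s \<omega> = (\<Sum>i<n. \<xi> i \<omega> * indicator {\<tau> i<..\<tau> (Suc i)} s)"

definition elementary_integral ::
    "(real \<Rightarrow> 'a \<Rightarrow> real) \<Rightarrow> nat \<Rightarrow> (nat \<Rightarrow> real) \<Rightarrow> (nat \<Rightarrow> 'a \<Rightarrow> real) \<Rightarrow> real \<Rightarrow> 'a \<Rightarrow> real" where
  "elementary_integral V n \<tau> \<xi> t \<omega> =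
     (\<Sum>i<n. \<xi> i \<omega> * (V (min (\<tau> (Suc i)) t) \<omega> - V (min (\<tau> i) t) \<omega>))"

text \<open>\<open>is_ito_integral M F V H I\<close>: the process \<open>I\<close> is (a version of) \<open>I\<^sub>t = \<integral>\<^sub>0\<^sup>t H\<^sub>s dV\<^sub>s\<close>, \<open>t \<ge> 0\<close>, that is,
  a continuous adapted process whose value at each time \<open>t\<close> is the limit in \<open>L\<^sup>2(M)\<close> of the
  integrals of bounded elementary processes converging to \<open>H\<close> in \<open>L\<^sup>2([0,t] \<times> M)\<close>. It is meant for
  \<open>V\<close> in \<^term>\<open>brownian_motions M F\<close> and \<open>H\<close> progressively measurable with
  \<open>E \<integral>\<^sub>0\<^sup>t H\<^sub>s\<^sup>2 ds < \<infinity>\<close>; by the Ito isometry \<open>I\<close> is then unique up to indistinguishability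
  and does not depend on the approximating sequence.\<close>

definition is_ito_integral ::
    "'a measure \<Rightarrow> (real \<Rightarrow> 'a measure) \<Rightarrow> (real \<Rightarrow> 'a \<Rightarrow> real) \<Rightarrow> (real \<Rightarrow> 'a \<Rightarrow> real) \<Rightarrow>
     (real \<Rightarrow> 'a \<Rightarrow> real) \<Rightarrow> bool" where
  "is_ito_integral M F V H I \<longleftrightarrow>
     adapted F I \<and> continuous_paths M I \<and>
     (\<forall>t\<ge>0. \<exists>n \<tau> \<xi>.
        (\<forall>k. elementary_integrand M F (n k) (\<tau> k) (\<xi> k)) \<and>
        (\<lambda>k. \<integral>\<^sup>+\<omega>. (\<integral>\<^sup>+s\<in>{0..t}.
             ennreal ((elementary_process (n k) (\<tau> k) (\<xi> k) s \<omega> - H s \<omega>)\<^sup>2) \<partial>lborel) \<partial>M)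
          \<longlonglongrightarrow> 0 \<and>
        (\<lambda>k. \<integral>\<^sup>+\<omega>. ennreal ((elementary_integral V (n k) (\<tau> k) (\<xi> k) t \<omega> - I t \<omega>)\<^sup>2) \<partial>M)
          \<longlonglongrightarrow> 0)"

definition sgn_conv :: "real \<Rightarrow> real \<Rightarrow> real" where
  "sgn_conv c x = (if x = 0 then c else sgn x)"

end

theory Submission
  imports Defs
begin

text \<open>
Write \<open>X' = X T - x\<close> and \<open>Y'(W) = Y W T - y\<close>. Both have mean zero, and by the Ito isometry their second
moments are \<open>E \<integral> H\<^sup>2\<close> and \<open>E \<integral> J\<^sup>2\<close> over \<open>[0, T]\<close>, whichever Brownian motion \<open>W\<close> drives \<open>Y\<close>. Expanding
the square, only the covariation term \<open>C W = E (X' Y'(W))\<close> depends on \<open>W\<close>, and the larger it is, the smaller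
is the expected squared distance. So two facts are needed. For every \<open>W\<close> one has \<open>\<bar>C W\<bar> \<le> E \<integral> \<bar>H J\<bar>\<close>
(\<open>covariation_le\<close>), a form of the Kunita-Watanabe inequality. For \<open>V = \<integral> \<epsilon> dB\<close> one has
\<open>C V = E \<integral> \<epsilon> H J\<close> (\<open>covariation_eq\<close>); the choices \<open>\<epsilon> = sgn (H J)\<close> and \<open>\<epsilon> = - sgn (H J)\<close> attain the two
extreme values.

The hypothesis on \<open>Y\<close> speaks of Brownian motions only, so \<open>\<integral> \<epsilon> dB\<close> with \<open>\<epsilon>\<close> valued in \<open>{1, -1}\<close> has to be
recognised as one (\<open>sign_integral_brownian\<close>). This case of Levy's characterisation has an elementary
proof. Replacing the coefficients of an approximating elementary integrand by their signs at most
doubles the distance to \<open>\<epsilon>\<close>, because a real number whose sign differs from \<open>\<epsilon>\<close> is at distance at least 1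
from \<open>\<epsilon>\<close>. Given the past, a sum of increments with random signs is exactly Gaussian, and its variance
is the total length of its intervals, which is deterministic. Its characteristic function on each
event of \<open>F s\<close> is therefore explicit, and it passes to the limit.

Everything about stochastic integrals is reduced to pairs \<open>(G, Z)\<close>, where \<open>G\<close> is a finite sum of blocks
\<open>\<xi> 1{a<..b}\<close>, possibly overlapping, and \<open>Z\<close> is the corresponding sum of \<open>\<xi> (W b - W a)\<close>
(\<open>simple_ito\<close>), and to the closure of these pairs under joint convergence in \<open>L\<^sup>2\<close> (\<open>ito_limit\<close>).
Allowing overlaps makes the pairs a vector space at once, so that the isometry is a bilinear induction
over blocks and no common refinement of partitions is needed.
\<close>

section \<open>Convergence in L2\<close>

definition square_integrable :: "'b measure \<Rightarrow> ('b \<Rightarrow> real) \<Rightarrow> bool" where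
  "square_integrable N f \<longleftrightarrow> f \<in> borel_measurable N \<and> integrable N (\<lambda>x. (f x)\<^sup>2)"

text \<open>The members of the sequence and the limit are included in the predicate as square integrable functions,
so that a single hypothesis carries everything that the integral calculus needs.\<close>

definition L2_lim :: "'b measure \<Rightarrow> (nat \<Rightarrow> 'b \<Rightarrow> real) \<Rightarrow> ('b \<Rightarrow> real) \<Rightarrow> bool" where
  "L2_lim N f g \<longleftrightarrow> (\<forall>k. square_integrable N (f k)) \<and> square_integrable N g \<and>
     (\<lambda>k. \<integral>x. (f k x - g x)\<^sup>2 \<partial>N) \<longlonglongrightarrow> 0"

lemma square_integrableD:
  assumes "square_integrable N f"
  shows "f \<in> borel_measurable N" "integrable N (\<lambda>x. (f x)\<^sup>2)"
  using assms by (auto simp: square_integrable_def)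

lemma square_integrable_bound:
  assumes "f \<in> borel_measurable N" "integrable N g" "\<And>x. x \<in> space N \<Longrightarrow> (f x)\<^sup>2 \<le> g x"
  shows "square_integrable N f"
  unfolding square_integrable_def
proof
  show "integrable N (\<lambda>x. (f x)\<^sup>2)"
    by (rule Bochner_Integration.integrable_bound[OF assms(2)])
      (use assms in \<open>auto intro!: AE_I2 order_trans[OF _ abs_ge_self]\<close>)
qed (use assms in auto)

lemma square_integrable_zero: "square_integrable N (\<lambda>_. 0)"
  by (simp add: square_integrable_def)

lemma square_sum_le: "(a + b)\<^sup>2 \<le> 2 * a\<^sup>2 + 2 * (b::real)\<^sup>2"
  using zero_le_power2[of "a - b"] by (simp add: power2_eq_square algebra_simps)

lemma square_integrable_add:
  assumes "square_integrable N f" "square_integrable N g"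
  shows "square_integrable N (\<lambda>x. f x + g x)"
  using assms by (intro square_integrable_bound[where g = "\<lambda>x. 2 * (f x)\<^sup>2 + 2 * (g x)\<^sup>2"])
    (auto simp: square_integrable_def square_sum_le)

lemma square_integrable_bounded_mult:
  assumes "square_integrable N f" "h \<in> borel_measurable N" "\<And>x. x \<in> space N \<Longrightarrow> \<bar>h x\<bar> \<le> C"
  shows "square_integrable N (\<lambda>x. h x * f x)"
proof (rule square_integrable_bound[where g = "\<lambda>x. C\<^sup>2 * (f x)\<^sup>2"])
  show "(h x * f x)\<^sup>2 \<le> C\<^sup>2 * (f x)\<^sup>2" if "x \<in> space N" for x
    using power_mono[OF assms(3)[OF that], of 2]
    by (simp add: power_mult_distrib mult_right_mono)
qed (use assms in \<open>auto simp: square_integrable_def\<close>)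

lemma square_integrable_cmult:
  "square_integrable N f \<Longrightarrow> square_integrable N (\<lambda>x. r * f x)"
  using square_integrable_bounded_mult[of N f "\<lambda>_. r" "\<bar>r\<bar>"] by simp

lemma square_integrable_diff:
  "square_integrable N f \<Longrightarrow> square_integrable N g \<Longrightarrow> square_integrable N (\<lambda>x. f x - g x)"
  using square_integrable_add[of N f "\<lambda>x. (-1) * g x"] square_integrable_cmult[of N g "-1"] by simp

lemma square_integrable_abs: "square_integrable N f \<Longrightarrow> square_integrable N (\<lambda>x. \<bar>f x\<bar>)"
  by (auto simp: square_integrable_def)

lemma integrable_product:
  assumes "square_integrable N f" "square_integrable N g"
  shows "integrable N (\<lambda>x. f x * g x)"
proof (rule Bochner_Integration.integrable_bound[where f = "\<lambda>x. (f x)\<^sup>2 + (g x)\<^sup>2"])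
  have "\<bar>a * b\<bar> \<le> a\<^sup>2 + (b::real)\<^sup>2" for a b
    using sum_squares_bound[of "\<bar>a\<bar>" "\<bar>b\<bar>"] abs_ge_zero[of "a * b"]
    unfolding abs_mult power2_abs by linarith
  then show "AE x in N. norm (f x * g x) \<le> norm ((f x)\<^sup>2 + (g x)\<^sup>2)"
    by (auto intro!: AE_I2 order_trans[OF _ abs_ge_self])
qed (use assms in \<open>auto simp: square_integrable_def\<close>)

lemma square_integrable_const: "finite_measure N \<Longrightarrow> square_integrable N (\<lambda>_. r)"
  by (simp add: square_integrable_def finite_measure.integrable_const)

text \<open>The nonnegative quadratic polynomial \<open>r \<mapsto> \<integral> (f - r g)\<^sup>2\<close> has no negative value at its minimiser; if its
leading coefficient vanishes, its linear coefficient has to vanish as well.\<close>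

lemma Cauchy_Schwarz_integral:
  assumes f: "square_integrable N f" and g: "square_integrable N g"
  shows "\<bar>\<integral>x. f x * g x \<partial>N\<bar> \<le> sqrt (\<integral>x. (f x)\<^sup>2 \<partial>N) * sqrt (\<integral>x. (g x)\<^sup>2 \<partial>N)"
proof -
  define A B C where "A = (\<integral>x. (f x)\<^sup>2 \<partial>N)" and "B = (\<integral>x. (g x)\<^sup>2 \<partial>N)"
    and "C = (\<integral>x. f x * g x \<partial>N)"
  have quad: "0 \<le> A - 2 * r * C + r\<^sup>2 * B" for r
  proof -
    have "0 \<le> (\<integral>x. (f x - r * g x)\<^sup>2 \<partial>N)" by simp
    also have "\<dots> = (\<integral>x. (f x)\<^sup>2 - 2 * r * (f x * g x) + r\<^sup>2 * (g x)\<^sup>2 \<partial>N)"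
      by (intro Bochner_Integration.integral_cong) (auto simp: power2_eq_square algebra_simps)
    also have "\<dots> = A - 2 * r * C + r\<^sup>2 * B"
      using integrable_product[OF f g] f g by (simp add: A_def B_def C_def square_integrable_def)
    finally show ?thesis .
  qed
  have nonneg: "0 \<le> A" "0 \<le> B" by (simp_all add: A_def B_def)
  have "C\<^sup>2 \<le> A * B"
  proof (cases "B = 0")
    case True
    have "C = 0"
    proof (rule ccontr)
      assume "C \<noteq> 0"
      \<comment> \<open>At this \<open>r\<close> the polynomial, linear since \<open>B = 0\<close>, takes the value \<open>-1\<close>.\<close>
      then show False using quad[of "(A + 1) / (2 * C)"] True by (simp add: field_simps)
    qed
    then show ?thesis using True by simp
  next
    case False
    then show ?thesis using quad[of "C / B"] nonneg
      by (simp add: field_simps power2_eq_square)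
  qed
  then have "sqrt (C\<^sup>2) \<le> sqrt (A * B)" by (rule real_sqrt_le_mono)
  then show ?thesis by (simp add: A_def B_def C_def real_sqrt_mult)
qed

lemma L2_limD:
  assumes "L2_lim N f g"
  shows "square_integrable N (f k)" "square_integrable N g"
    "(\<lambda>k. \<integral>x. (f k x - g x)\<^sup>2 \<partial>N) \<longlonglongrightarrow> 0"
  using assms by (auto simp: L2_lim_def)

text \<open>Used to transfer a known convergence: \<open>h\<close> is a combination of squared
distances to known \<open>L\<^sup>2\<close> limits.\<close>

lemma L2_lim_dominated:
  assumes "\<And>k. square_integrable N (f k)" "square_integrable N g"
    and "\<And>k. integrable N (h k)" "(\<lambda>k. \<integral>x. h k x \<partial>N) \<longlonglongrightarrow> 0"
    and "\<And>k x. x \<in> space N \<Longrightarrow> (f k x - g x)\<^sup>2 \<le> h k x"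
  shows "L2_lim N f g"
  unfolding L2_lim_def
proof (intro conjI allI)
  show "(\<lambda>k. \<integral>x. (f k x - g x)\<^sup>2 \<partial>N) \<longlonglongrightarrow> 0"
  proof (rule tendsto_sandwich[OF _ _ tendsto_const assms(4)])
    show "\<forall>\<^sub>F k in sequentially. (\<integral>x. (f k x - g x)\<^sup>2 \<partial>N) \<le> (\<integral>x. h k x \<partial>N)"
      using square_integrable_diff[OF assms(1,2)] assms(3,5)
      by (intro always_eventually allI integral_mono) (auto simp: square_integrable_def)
  qed auto
qed (use assms in auto)

lemma L2_lim_const: "square_integrable N f \<Longrightarrow> L2_lim N (\<lambda>_. f) f"
  by (simp add: L2_lim_def)

lemma L2_lim_add:
  assumes "L2_lim N f g" "L2_lim N f' g'"
  shows "L2_lim N (\<lambda>k x. f k x + f' k x) (\<lambda>x. g x + g' x)"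
proof (rule L2_lim_dominated[where h = "\<lambda>k x. 2 * (f k x - g x)\<^sup>2 + 2 * (f' k x - g' x)\<^sup>2"])
  note D = square_integrable_diff[OF L2_limD(1,2)[OF assms(1)]]
    square_integrable_diff[OF L2_limD(1,2)[OF assms(2)]]
  show "integrable N (\<lambda>x. 2 * (f k x - g x)\<^sup>2 + 2 * (f' k x - g' x)\<^sup>2)" for k
    using D[of k] by (auto simp: square_integrable_def)
  have "(\<lambda>k. 2 * (\<integral>x. (f k x - g x)\<^sup>2 \<partial>N) + 2 * (\<integral>x. (f' k x - g' x)\<^sup>2 \<partial>N)) \<longlonglongrightarrow> 2 * 0 + 2 * 0"
    using assms by (intro tendsto_intros) (auto simp: L2_lim_def)
  then show "(\<lambda>k. \<integral>x. 2 * (f k x - g x)\<^sup>2 + 2 * (f' k x - g' x)\<^sup>2 \<partial>N) \<longlonglongrightarrow> 0"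
    using D by (simp add: square_integrable_def)
  show "(f k x + f' k x - (g x + g' x))\<^sup>2 \<le> 2 * (f k x - g x)\<^sup>2 + 2 * (f' k x - g' x)\<^sup>2" for k x
    using square_sum_le[of "f k x - g x" "f' k x - g' x"] by (simp add: algebra_simps)
qed (use assms in \<open>auto intro!: square_integrable_add simp: L2_lim_def\<close>)

lemma L2_lim_bounded_mult:
  assumes "L2_lim N f g" "h \<in> borel_measurable N" "\<And>x. x \<in> space N \<Longrightarrow> \<bar>h x\<bar> \<le> C"
  shows "L2_lim N (\<lambda>k x. h x * f k x) (\<lambda>x. h x * g x)"
proof (rule L2_lim_dominated[where h = "\<lambda>k x. C\<^sup>2 * (f k x - g x)\<^sup>2"])
  show "integrable N (\<lambda>x. C\<^sup>2 * (f k x - g x)\<^sup>2)" for k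
    using square_integrable_diff[OF L2_limD(1,2)[OF assms(1)], of k]
    by (simp add: square_integrable_def)
  show "(\<lambda>k. \<integral>x. C\<^sup>2 * (f k x - g x)\<^sup>2 \<partial>N) \<longlonglongrightarrow> 0"
    using tendsto_mult_left[OF L2_limD(3)[OF assms(1)], of "C\<^sup>2"] by simp
  show "(h x * f k x - h x * g x)\<^sup>2 \<le> C\<^sup>2 * (f k x - g x)\<^sup>2" if "x \<in> space N" for k x
    using power_mono[OF assms(3)[OF that], of 2]
    by (simp add: power_mult_distrib mult_right_mono flip: right_diff_distrib)
qed (use assms in \<open>auto intro!: square_integrable_bounded_mult simp: L2_lim_def\<close>)

lemma L2_lim_abs: "L2_lim N f g \<Longrightarrow> L2_lim N (\<lambda>k x. \<bar>f k x\<bar>) (\<lambda>x. \<bar>g x\<bar>)"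
proof (rule L2_lim_dominated[where h = "\<lambda>k x. (f k x - g x)\<^sup>2"])
  assume l: "L2_lim N f g"
  show "integrable N (\<lambda>x. (f k x - g x)\<^sup>2)" for k
    using square_integrable_diff[OF L2_limD(1,2)[OF l], of k] by (simp add: square_integrable_def)
  show "(\<lambda>k. \<integral>x. (f k x - g x)\<^sup>2 \<partial>N) \<longlonglongrightarrow> 0" by (rule L2_limD(3)[OF l])
  show "(\<bar>f k x\<bar> - \<bar>g x\<bar>)\<^sup>2 \<le> (f k x - g x)\<^sup>2" for k x
    using abs_le_square_iff[of "\<bar>f k x\<bar> - \<bar>g x\<bar>" "f k x - g x"] abs_triangle_ineq3 by blast
qed (auto intro!: square_integrable_abs simp: L2_lim_def)

text \<open>Continuity of the inner product. With \<open>f = f'\<close> it also gives convergence of the norms.\<close>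

lemma L2_lim_integral_mult:
  assumes "L2_lim N f g" "L2_lim N f' g'"
  shows "(\<lambda>k. \<integral>x. f k x * f' k x \<partial>N) \<longlonglongrightarrow> (\<integral>x. g x * g' x \<partial>N)"
proof -
  note L = L2_limD[OF assms(1)] and L' = L2_limD[OF assms(2)]
  define d d' where "d k = sqrt (\<integral>x. (f k x - g x)\<^sup>2 \<partial>N)"
    and "d' k = sqrt (\<integral>x. (f' k x - g' x)\<^sup>2 \<partial>N)" for k
  define n n' where "n = sqrt (\<integral>x. (g x)\<^sup>2 \<partial>N)" and "n' = sqrt (\<integral>x. (g' x)\<^sup>2 \<partial>N)"
  have d: "d \<longlonglongrightarrow> 0" "d' \<longlonglongrightarrow> 0"
    using tendsto_real_sqrt[OF L(3)] tendsto_real_sqrt[OF L'(3)] by (simp_all add: d_def[abs_def] d'_def[abs_def])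
  have bound: "\<bar>(\<integral>x. f k x * f' k x \<partial>N) - (\<integral>x. g x * g' x \<partial>N)\<bar> \<le> d k * d' k + d k * n' + n * d' k" for k
  proof -
    note D = square_integrable_diff[OF L(1)[of k] L(2)]
      and D' = square_integrable_diff[OF L'(1)[of k] L'(2)]
    have "(\<integral>x. f k x * f' k x \<partial>N) - (\<integral>x. g x * g' x \<partial>N) =
      (\<integral>x. (f k x - g x) * (f' k x - g' x) + (f k x - g x) * g' x + g x * (f' k x - g' x) \<partial>N)"
      using integrable_product[OF L(1)[of k] L'(1)[of k]] integrable_product[OF L(2) L'(2)]
      by (simp flip: Bochner_Integration.integral_diff) (simp add: algebra_simps)
    also have "\<dots> = (\<integral>x. (f k x - g x) * (f' k x - g' x) \<partial>N) + (\<integral>x. (f k x - g x) * g' x \<partial>N)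
       + (\<integral>x. g x * (f' k x - g' x) \<partial>N)"
      using integrable_product[OF D D'] integrable_product[OF D L'(2)] integrable_product[OF L(2) D']
      by simp
    finally show ?thesis
      using Cauchy_Schwarz_integral[OF D D'] Cauchy_Schwarz_integral[OF D L'(2)]
        Cauchy_Schwarz_integral[OF L(2) D']
      unfolding d_def d'_def n_def n'_def by linarith
  qed
  have "(\<lambda>k. d k * d' k + d k * n' + n * d' k) \<longlonglongrightarrow> 0 * 0 + 0 * n' + n * 0"
    by (intro tendsto_intros d)
  then have "(\<lambda>k. d k * d' k + d k * n' + n * d' k) \<longlonglongrightarrow> 0" by simp
  then have "(\<lambda>k. (\<integral>x. f k x * f' k x \<partial>N) - (\<integral>x. g x * g' x \<partial>N)) \<longlonglongrightarrow> 0"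
    by (rule Lim_null_comparison[rotated]) (use bound in auto)
  then show ?thesis by (simp add: LIM_zero_iff)
qed

text \<open>Bridges the extended-valued convergence in the definition of the Ito integral to \<open>L2_lim\<close>. The limit
is square integrable because some distance in the sequence is finite.\<close>

lemma L2_lim_nn_integral:
  assumes f: "\<And>k. square_integrable N (f k)" and g: "g \<in> borel_measurable N"
    and lim: "(\<lambda>k. \<integral>\<^sup>+x. ennreal ((f k x - g x)\<^sup>2) \<partial>N) \<longlonglongrightarrow> 0"
  shows "L2_lim N f g"
proof -
  have "\<forall>\<^sub>F k in sequentially. (\<integral>\<^sup>+x. ennreal ((f k x - g x)\<^sup>2) \<partial>N) < \<infinity>"
    using order_tendstoD(2)[OF lim, of \<infinity>] by simp
  then obtain k where "(\<integral>\<^sup>+x. ennreal ((f k x - g x)\<^sup>2) \<partial>N) < \<infinity>"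
    by (auto simp: eventually_sequentially)
  then have "integrable N (\<lambda>x. (f k x - g x)\<^sup>2)"
    using f[of k] g by (intro integrableI_nonneg) (auto simp: square_integrable_def)
  then have "square_integrable N (\<lambda>x. f k x - g x)"
    using f[of k] g by (auto simp: square_integrable_def)
  from square_integrable_diff[OF f[of k] this] have g2: "square_integrable N g" by simp
  have "(\<integral>\<^sup>+x. ennreal ((f k x - g x)\<^sup>2) \<partial>N) = ennreal (\<integral>x. (f k x - g x)\<^sup>2 \<partial>N)" for k
    using square_integrable_diff[OF f g2, of k]
    by (intro nn_integral_eq_integral) (auto simp: square_integrable_def)
  then have "(\<lambda>k. ennreal (\<integral>x. (f k x - g x)\<^sup>2 \<partial>N)) \<longlonglongrightarrow> ennreal 0"
    using lim by simp
  then have "(\<lambda>k. \<integral>x. (f k x - g x)\<^sup>2 \<partial>N) \<longlonglongrightarrow> 0"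
    by (rule tendsto_ennrealD) (auto intro!: always_eventually)
  then show ?thesis using f g2 by (simp add: L2_lim_def)
qed

section \<open>Increments of Brownian motions\<close>

sublocale filtered_prob_space \<subseteq> PM: pair_sigma_finite lborel M ..

context filtered_prob_space
begin

lemma space_F: "0 \<le> t \<Longrightarrow> space (F t) = space M"
  using subalgebra_filtration by (simp add: subalgebra_def)

lemma F_mono_measurable: "f \<in> measurable (F s) N \<Longrightarrow> 0 \<le> s \<Longrightarrow> s \<le> t \<Longrightarrow> f \<in> measurable (F t) N"
  using measurable_from_subalg[OF filtration_mono] by blast

lemma F_measurable: "f \<in> measurable (F s) N \<Longrightarrow> 0 \<le> s \<Longrightarrow> f \<in> measurable M N"
  using measurable_from_subalg[OF subalgebra_filtration] by blast

lemma increment_F_measurable: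
  assumes "W \<in> brownian_motions M F" "0 \<le> a" "a \<le> b" "b \<le> c"
  shows "(\<lambda>\<omega>. W b \<omega> - W a \<omega>) \<in> borel_measurable (F c)"
proof -
  have "W t \<in> borel_measurable (F c)" if "0 \<le> t" "t \<le> c" for t
    using assms that by (auto simp: brownian_motions_def adapted_def intro: F_mono_measurable)
  then show ?thesis using assms by (intro borel_measurable_diff) auto
qed

lemma increment_measurable:
  assumes "W \<in> brownian_motions M F" "0 \<le> a" "a \<le> b"
  shows "(\<lambda>\<omega>. W b \<omega> - W a \<omega>) \<in> borel_measurable M"
  using F_measurable[OF increment_F_measurable[OF assms order_refl]] assms by auto

lemma increment_normal:
  assumes "W \<in> brownian_motions M F" "0 \<le> a" "a < b"
  shows "distributed M lborel (\<lambda>\<omega>. W b \<omega> - W a \<omega>) (normal_density 0 (sqrt (b - a)))"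
  using assms by (simp add: brownian_motions_def)

lemma increment_indep:
  assumes W: "W \<in> brownian_motions M F" "0 \<le> a" "a < b" and \<Phi>: "\<Phi> \<in> measurable (F a) N"
    and g: "g \<in> measurable borel N'"
  shows "indep_var N \<Phi> N' (\<lambda>\<omega>. g (W b \<omega> - W a \<omega>))"
proof -
  let ?D = "\<lambda>\<omega>. W b \<omega> - W a \<omega>"
  have D[measurable]: "?D \<in> borel_measurable M" using increment_measurable[OF W(1,2)] W(3) by simp
  have ind: "indep_set (sets (F a)) (sets (vimage_algebra (space M) ?D borel))"
    using W by (simp add: brownian_motions_def)
  have 1: "sigma_sets (space M) {\<Phi> -` A \<inter> space M | A. A \<in> sets N} \<subseteq> sets (F a)"
    unfolding space_F[OF W(2), symmetric]
    by (rule sets.sigma_sets_subset) (use measurable_sets[OF \<Phi>] in auto)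
  have "(\<lambda>\<omega>. g (?D \<omega>)) \<in> measurable (vimage_algebra (space M) ?D borel) N'"
    by (rule measurable_compose[OF measurable_vimage_algebra1 g]) auto
  from measurable_sets[OF this]
  have pre: "(\<lambda>\<omega>. g (?D \<omega>)) -` A \<inter> space M \<in> sets (vimage_algebra (space M) ?D borel)"
    if "A \<in> sets N'" for A using that by simp
  have 2: "sigma_sets (space M) {(\<lambda>\<omega>. g (?D \<omega>)) -` A \<inter> space M | A. A \<in> sets N'}
      \<subseteq> sets (vimage_algebra (space M) ?D borel)"
    using sets.sigma_sets_subset[of "{(\<lambda>\<omega>. g (?D \<omega>)) -` A \<inter> space M | A. A \<in> sets N'}"
        "vimage_algebra (space M) ?D borel"] pre by auto
  show ?thesis
    unfolding indep_var_eq
  proof (intro conjI)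
    show "random_variable N \<Phi>" using F_measurable[OF \<Phi> W(2)] .
    show "random_variable N' (\<lambda>\<omega>. g (?D \<omega>))" using D g by (rule measurable_compose)
    show "indep_set (sigma_sets (space M) {\<Phi> -` A \<inter> space M |A. A \<in> sets N})
     (sigma_sets (space M) {(\<lambda>\<omega>. g (?D \<omega>)) -` A \<inter> space M |A. A \<in> sets N'})"
      using ind 1 2 unfolding indep_sets2_eq by (meson subsetD subset_trans)
  qed
qed

text \<open>The increment over \<open>{a<..b}\<close> is independent of \<open>F a\<close>. The value type is general so that the lemma serves both
for moments and, with complex exponentials, for characteristic functions.\<close>

lemma increment_product:
  fixes \<Phi> :: "'a \<Rightarrow> 'b::{real_normed_field, banach, second_countable_topology}"
  assumes W: "W \<in> brownian_motions M F" "0 \<le> a" "a \<le> b"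
    and \<Phi>: "\<Phi> \<in> borel_measurable (F a)" "integrable M \<Phi>"
    and g: "g \<in> borel_measurable borel" "integrable M (\<lambda>\<omega>. g (W b \<omega> - W a \<omega>))"
  shows "expectation (\<lambda>\<omega>. \<Phi> \<omega> * g (W b \<omega> - W a \<omega>)) =
    expectation \<Phi> * expectation (\<lambda>\<omega>. g (W b \<omega> - W a \<omega>))"
proof (cases "a = b")
  case True then show ?thesis by (simp add: prob_space)
next
  case False
  with W show ?thesis
    by (intro indep_var_lebesgue_integral increment_indep \<Phi> g) auto
qed

lemma
  assumes "W \<in> brownian_motions M F" "0 \<le> a" "a \<le> b"
  shows increment_square_integrable: "square_integrable M (\<lambda>\<omega>. W b \<omega> - W a \<omega>)"
    and increment_mean: "expectation (\<lambda>\<omega>. W b \<omega> - W a \<omega>) = 0"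
    and increment_variance: "expectation (\<lambda>\<omega>. (W b \<omega> - W a \<omega>)\<^sup>2) = b - a"
proof -
  let ?D = "\<lambda>\<omega>. W b \<omega> - W a \<omega>"
  have "square_integrable M ?D \<and> expectation ?D = 0 \<and> expectation (\<lambda>\<omega>. (?D \<omega>)\<^sup>2) = b - a"
  proof (cases "a = b")
    case True then show ?thesis by (simp add: square_integrable_def)
  next
    case False
    then have ab: "a < b" "0 < sqrt (b - a)" using assms by auto
    note D = increment_normal[OF assms(1,2) ab(1)]
    have m: "?D \<in> borel_measurable M" by (rule increment_measurable[OF assms])
    have "integrable lborel (\<lambda>x. normal_density 0 (sqrt (b - a)) x * x\<^sup>2)"
      using integrable_normal_moment[OF ab(2), of 0 2] by simp
    then have "integrable M (\<lambda>\<omega>. (?D \<omega>)\<^sup>2)"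
      by (subst (asm) distributed_integrable[OF D]) auto
    moreover have e0: "expectation ?D = 0" by (rule normal_distributed_expectation[OF ab(2) D])
    moreover have "expectation (\<lambda>\<omega>. (?D \<omega>)\<^sup>2) = b - a"
      using normal_distributed_variance[OF ab(2) D] ab by (simp add: e0)
    ultimately show ?thesis using m by (simp add: square_integrable_def)
  qed
  then show "square_integrable M ?D" "expectation ?D = 0" "expectation (\<lambda>\<omega>. (?D \<omega>)\<^sup>2) = b - a"
    by auto
qed

lemma increment_orthogonal:
  assumes W: "W \<in> brownian_motions M F" "0 \<le> a" "a \<le> b"
    and \<Phi>: "\<Phi> \<in> borel_measurable (F a)" "square_integrable M \<Phi>"
  shows "expectation (\<lambda>\<omega>. \<Phi> \<omega> * (W b \<omega> - W a \<omega>)) = 0"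
proof -
  have int: "integrable M f" if "square_integrable M f" for f
    using integrable_product[OF that square_integrable_const[OF finite_measure_axioms, of 1]] by simp
  show ?thesis
    using increment_product[OF W \<Phi>(1) int[OF \<Phi>(2)], of "\<lambda>x. x"]
      int[OF increment_square_integrable[OF W]] increment_mean[OF W] by simp
qed

text \<open>The coefficients admitted in an elementary integrand on an interval that starts at time \<open>a\<close>.\<close>

definition bounded_at :: "real \<Rightarrow> ('a \<Rightarrow> real) \<Rightarrow> bool" where
  "bounded_at a \<xi> \<longleftrightarrow> \<xi> \<in> borel_measurable (F a) \<and> (\<exists>C. \<forall>\<omega>\<in>space M. \<bar>\<xi> \<omega>\<bar> \<le> C)"

lemma bounded_at_mult:
  assumes "bounded_at a \<xi>" "bounded_at a \<eta>" shows "bounded_at a (\<lambda>\<omega>. \<xi> \<omega> * \<eta> \<omega>)"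
proof -
  obtain C D where C: "\<forall>\<omega>\<in>space M. \<bar>\<xi> \<omega>\<bar> \<le> C" and D: "\<forall>\<omega>\<in>space M. \<bar>\<eta> \<omega>\<bar> \<le> D"
    using assms by (auto simp: bounded_at_def)
  have "\<forall>\<omega>\<in>space M. \<bar>\<xi> \<omega> * \<eta> \<omega>\<bar> \<le> C * D"
    using C D by (auto simp: abs_mult intro!: mult_mono intro: order_trans[OF abs_ge_zero])
  then show ?thesis using assms by (auto simp: bounded_at_def)
qed

lemma bounded_at_mono: "bounded_at a \<xi> \<Longrightarrow> 0 \<le> a \<Longrightarrow> a \<le> b \<Longrightarrow> bounded_at b \<xi>"
  by (auto simp: bounded_at_def intro: F_mono_measurable)

lemma bounded_at_abs: "bounded_at a \<xi> \<Longrightarrow> bounded_at a (\<lambda>\<omega>. \<bar>\<xi> \<omega>\<bar>)"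
  by (auto simp: bounded_at_def)

lemma bounded_at_const: "bounded_at a (\<lambda>_. r)"
  by (auto simp: bounded_at_def)

lemma bounded_at_integrable: "bounded_at a \<xi> \<Longrightarrow> 0 \<le> a \<Longrightarrow> integrable M \<xi>"
  unfolding bounded_at_def
  by (elim conjE exE, rule integrable_const_bound) (auto intro!: AE_I2 F_measurable)

lemma bounded_at_square_integrable:
  "bounded_at a \<xi> \<Longrightarrow> 0 \<le> a \<Longrightarrow> square_integrable M f \<Longrightarrow> square_integrable M (\<lambda>\<omega>. \<xi> \<omega> * f \<omega>)"
  by (auto simp: bounded_at_def intro: square_integrable_bounded_mult F_measurable)

text \<open>The conditional variance of an increment given the past is its length.\<close>

lemma weighted_increment_variance:
  assumes W: "W \<in> brownian_motions M F" "0 \<le> a" "a \<le> b" and \<xi>: "bounded_at a \<xi>"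
  shows "expectation (\<lambda>\<omega>. \<xi> \<omega> * (W b \<omega> - W a \<omega>)\<^sup>2) = expectation \<xi> * (b - a)"
  using increment_product[OF W _ bounded_at_integrable[OF \<xi> W(2)], of "\<lambda>x. x\<^sup>2"] \<xi>
    increment_square_integrable[OF W] increment_variance[OF W]
  by (simp add: square_integrable_def bounded_at_def)

text \<open>Only the common part of the two intervals contributes: any product of increments over consecutive
intervals has mean zero against a weight known at the start of the later one, even if the increments belong
to different Brownian motions. Here \<open>{c<..q}\<close> is the common part, empty with \<open>q = c\<close> if there is none.\<close>

lemma block_covariation_ordered:
  assumes W: "W \<in> brownian_motions M F" and V: "V \<in> brownian_motions M F"
    and ab: "0 \<le> a" "a \<le> b" and cd: "a \<le> c" "c \<le> d"
    and \<xi>: "bounded_at a \<xi>" and \<eta>: "bounded_at c \<eta>"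
    and q: "q = max c (min b d)"
  shows "expectation (\<lambda>\<omega>. (\<xi> \<omega> * (W b \<omega> - W a \<omega>)) * (\<eta> \<omega> * (V d \<omega> - V c \<omega>))) =
    expectation (\<lambda>\<omega>. (\<xi> \<omega> * \<eta> \<omega>) * ((W q \<omega> - W c \<omega>) * (V q \<omega> - V c \<omega>)))"
proof -
  define \<zeta> where "\<zeta> \<omega> = \<xi> \<omega> * \<eta> \<omega>" for \<omega>
  have c: "0 \<le> c" using ab cd by simp
  have \<zeta>: "bounded_at c \<zeta>" unfolding \<zeta>_def[abs_def]
    using bounded_at_mult[OF bounded_at_mono[OF \<xi>] \<eta>] ab cd by simp
  have sqi: "square_integrable M (\<lambda>\<omega>. \<zeta> \<omega> * (U t \<omega> - U s \<omega>))"
    if "U \<in> brownian_motions M F" "0 \<le> s" "s \<le> t" for U s t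
    using bounded_at_square_integrable[OF \<zeta> c increment_square_integrable[OF that]] .
  have int: "integrable M (\<lambda>\<omega>. \<zeta> \<omega> * (U t \<omega> - U s \<omega>) * (U' t' \<omega> - U' s' \<omega>))"
    if "U \<in> brownian_motions M F" "0 \<le> s" "s \<le> t" "U' \<in> brownian_motions M F" "0 \<le> s'" "s' \<le> t'"
    for U s t U' s' t'
    using integrable_product[OF sqi increment_square_integrable] that by auto
  have orth: "expectation (\<lambda>\<omega>. \<zeta> \<omega> * (U t \<omega> - U s \<omega>) * (U' t' \<omega> - U' s' \<omega>)) = 0"
    if "U \<in> brownian_motions M F" "0 \<le> s" "s \<le> t" "t \<le> s'" "U' \<in> brownian_motions M F" "c \<le> s'" "s' \<le> t'"
    for U s t U' s' t'
  proof (rule increment_orthogonal[OF that(5)])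
    show "(\<lambda>\<omega>. \<zeta> \<omega> * (U t \<omega> - U s \<omega>)) \<in> borel_measurable (F s')"
      using bounded_at_mono[OF \<zeta> c that(6)] increment_F_measurable[OF that(1,2,3,4)]
      by (auto simp: bounded_at_def)
  qed (use that c sqi in auto)
  show ?thesis
  proof (cases "b \<le> c")
    case True
    with q have "q = c" using cd by auto
    then show ?thesis
      using orth[OF W ab True V _ cd(2)] by (simp add: \<zeta>_def mult_ac)
  next
    case False
    with q have q': "q = min b d" "c \<le> q" "q \<le> b" "q \<le> d" using cd by auto
    \<comment> \<open>Split the first interval at \<open>c\<close> and both at \<open>q\<close>; one of the pieces after \<open>q\<close> is empty.\<close>
    have eq: "(\<xi> \<omega> * (W b \<omega> - W a \<omega>)) * (\<eta> \<omega> * (V d \<omega> - V c \<omega>)) =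
        \<zeta> \<omega> * (W c \<omega> - W a \<omega>) * (V d \<omega> - V c \<omega>)
      + \<zeta> \<omega> * (W q \<omega> - W c \<omega>) * (V q \<omega> - V c \<omega>)
      + \<zeta> \<omega> * (W q \<omega> - W c \<omega>) * (V d \<omega> - V q \<omega>)
      + \<zeta> \<omega> * (V d \<omega> - V c \<omega>) * (W b \<omega> - W q \<omega>)" for \<omega>
      by (simp add: \<zeta>_def algebra_simps)
    have 4: "expectation (\<lambda>\<omega>. \<zeta> \<omega> * (V d \<omega> - V c \<omega>) * (W b \<omega> - W q \<omega>)) = 0"
    proof (cases "q = b")
      case False
      then have "q = d" using q' by linarith
      then show ?thesis using orth[OF V c cd(2) _ W, of q b] q' by simp
    qed simp
    have 1: "expectation (\<lambda>\<omega>. \<zeta> \<omega> * (W c \<omega> - W a \<omega>) * (V d \<omega> - V c \<omega>)) = 0"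
      by (rule orth) (use assms in auto)
    have 3: "expectation (\<lambda>\<omega>. \<zeta> \<omega> * (W q \<omega> - W c \<omega>) * (V d \<omega> - V q \<omega>)) = 0"
      by (rule orth) (use assms q' c in auto)
    have ints: "integrable M (\<lambda>\<omega>. \<zeta> \<omega> * (W c \<omega> - W a \<omega>) * (V d \<omega> - V c \<omega>))"
      "integrable M (\<lambda>\<omega>. \<zeta> \<omega> * (W q \<omega> - W c \<omega>) * (V q \<omega> - V c \<omega>))"
      "integrable M (\<lambda>\<omega>. \<zeta> \<omega> * (W q \<omega> - W c \<omega>) * (V d \<omega> - V q \<omega>))"
      "integrable M (\<lambda>\<omega>. \<zeta> \<omega> * (V d \<omega> - V c \<omega>) * (W b \<omega> - W q \<omega>))"
      by (intro int W V; use assms q' c in simp)+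
    show ?thesis
      unfolding eq using ints by (simp add: 1 3 4) (simp add: \<zeta>_def mult.assoc)
  qed
qed

lemma block_covariation:
  assumes W: "W \<in> brownian_motions M F" and V: "V \<in> brownian_motions M F"
    and ab: "0 \<le> a" "a \<le> b" and cd: "0 \<le> c" "c \<le> d"
    and \<xi>: "bounded_at a \<xi>" and \<eta>: "bounded_at c \<eta>"
    and p: "p = max a c" and q: "q = max p (min b d)"
  shows "expectation (\<lambda>\<omega>. (\<xi> \<omega> * (W b \<omega> - W a \<omega>)) * (\<eta> \<omega> * (V d \<omega> - V c \<omega>))) =
    expectation (\<lambda>\<omega>. (\<xi> \<omega> * \<eta> \<omega>) * ((W q \<omega> - W p \<omega>) * (V q \<omega> - V p \<omega>)))"
proof (cases "a \<le> c")
  case True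
  then have "p = c" using p by simp
  then show ?thesis using block_covariation_ordered[OF W V ab True cd(2) \<xi> \<eta>, of q] q by simp
next
  case False
  then have "p = a" "c \<le> a" using p by auto
  then show ?thesis
    using block_covariation_ordered[OF V W cd _ ab(2) \<eta> \<xi>, of q] q
    by (simp add: mult_ac min.commute)
qed

end

section \<open>Blocks and the product measure\<close>

context filtered_prob_space
begin

text \<open>One summand of an elementary integrand, as a function on \<open>real \<times> \<Omega>\<close>; integrals of blocks
against \<^term>\<open>lborel \<Otimes>\<^sub>M M\<close> are the expected time integrals.\<close>

definition block :: "('a \<Rightarrow> real) \<Rightarrow> real \<Rightarrow> real \<Rightarrow> real \<times> 'a \<Rightarrow> real" where
  "block \<xi> a b = (\<lambda>(s, \<omega>). \<xi> \<omega> * indicator {a<..b} s)"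

lemma block_measurable:
  assumes "bounded_at a \<xi>" "0 \<le> a"
  shows "block \<xi> u v \<in> borel_measurable (lborel \<Otimes>\<^sub>M M)"
proof -
  have [measurable]: "\<xi> \<in> borel_measurable M" using assms by (auto simp: bounded_at_def intro: F_measurable)
  show ?thesis unfolding block_def by measurable
qed

lemma block_integral:
  assumes \<xi>: "bounded_at a \<xi>" "0 \<le> a" and uv: "u \<le> v"
  shows "integrable (lborel \<Otimes>\<^sub>M M) (block \<xi> u v)"
    and "(\<integral>z. block \<xi> u v z \<partial>(lborel \<Otimes>\<^sub>M M)) = expectation \<xi> * (v - u)"
proof -
  have [measurable]: "\<xi> \<in> borel_measurable M" using \<xi> by (auto simp: bounded_at_def intro: F_measurable)
  obtain C where C: "\<forall>\<omega>\<in>space M. \<bar>\<xi> \<omega>\<bar> \<le> C" using \<xi> by (auto simp: bounded_at_def)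
  show int: "integrable (lborel \<Otimes>\<^sub>M M) (block \<xi> u v)"
  proof (rule Bochner_Integration.integrable_bound[where f = "\<lambda>z. C * indicator ({u<..v} \<times> space M) z"])
    have "emeasure (lborel \<Otimes>\<^sub>M M) ({u<..v} \<times> space M) < \<infinity>"
      using uv by (simp add: emeasure_pair_measure_Times emeasure_space_1 ennreal_mult_less_top)
    then show "integrable (lborel \<Otimes>\<^sub>M M) (\<lambda>z. C * indicator ({u<..v} \<times> space M) z)"
      by (intro integrable_mult_right integrable_real_indicator) auto
    show "AE z in lborel \<Otimes>\<^sub>M M. norm (block \<xi> u v z) \<le> norm (C * indicator ({u<..v} \<times> space M) z)"
      using C by (intro AE_I2) (auto simp: block_def space_pair_measure indicator_def intro: order_trans[OF _ abs_ge_self])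
  qed (use block_measurable[OF \<xi>] in auto)
  have "(\<integral>z. block \<xi> u v z \<partial>(lborel \<Otimes>\<^sub>M M)) = (\<integral>\<omega>. (\<integral>s. \<xi> \<omega> * indicator {u<..v} s \<partial>lborel) \<partial>M)"
    using PM.integral_snd[of "\<lambda>s \<omega>. \<xi> \<omega> * indicator {u<..v} s"] int by (simp add: block_def)
  also have "\<dots> = (\<integral>\<omega>. \<xi> \<omega> * (v - u) \<partial>M)" using uv by simp
  also have "\<dots> = expectation \<xi> * (v - u)" by simp
  finally show "(\<integral>z. block \<xi> u v z \<partial>(lborel \<Otimes>\<^sub>M M)) = expectation \<xi> * (v - u)" .
qed

text \<open>The maximum with \<open>max a c\<close> keeps the interval endpoints ordered when the intervals are disjoint.\<close>

lemma block_mult: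
  "block \<xi> a b z * block \<eta> c d z = block (\<lambda>\<omega>. \<xi> \<omega> * \<eta> \<omega>) (max a c) (max (max a c) (min b d)) z"
  by (auto simp: block_def indicator_def split: prod.splits)

lemma block_square_integrable:
  assumes "bounded_at a \<xi>" "0 \<le> a" "u \<le> v"
  shows "square_integrable (lborel \<Otimes>\<^sub>M M) (block \<xi> u v)"
proof -
  have "(block \<xi> u v z)\<^sup>2 = block (\<lambda>\<omega>. \<xi> \<omega> * \<xi> \<omega>) u v z" for z
    using assms(3) by (auto simp: block_def power2_eq_square split: split_indicator prod.splits)
  then show ?thesis unfolding square_integrable_def
    using block_measurable[OF assms(1,2)] block_integral(1)[OF bounded_at_mult[OF assms(1,1)] assms(2,3)]
    by simp
qed

text \<open>On the common interval the product of increments is a square, whose conditional mean is the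
length.\<close>

lemma block_isometry:
  assumes W: "W \<in> brownian_motions M F"
    and ab: "0 \<le> a" "a \<le> b" and cd: "0 \<le> c" "c \<le> d"
    and \<xi>: "bounded_at a \<xi>" and \<eta>: "bounded_at c \<eta>"
  shows "expectation (\<lambda>\<omega>. (\<xi> \<omega> * (W b \<omega> - W a \<omega>)) * (\<eta> \<omega> * (W d \<omega> - W c \<omega>))) =
    (\<integral>z. block \<xi> a b z * block \<eta> c d z \<partial>(lborel \<Otimes>\<^sub>M M))"
proof -
  define p where "p = max a c"
  define q where "q = max p (min b d)"
  have pq: "0 \<le> p" "a \<le> p" "c \<le> p" "p \<le> q" using ab by (auto simp: p_def q_def)
  have \<zeta>: "bounded_at p (\<lambda>\<omega>. \<xi> \<omega> * \<eta> \<omega>)"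
    using bounded_at_mult[OF bounded_at_mono[OF \<xi>] bounded_at_mono[OF \<eta>]] ab cd pq by auto
  show ?thesis
    unfolding block_covariation[OF W W ab cd \<xi> \<eta> p_def q_def] block_mult
    unfolding p_def[symmetric] q_def[symmetric] block_integral(2)[OF \<zeta> pq(1,4)]
    using weighted_increment_variance[OF W pq(1,4) \<zeta>] by (simp add: power2_eq_square)
qed

text \<open>On the common interval use \<open>2 \<bar>u v\<bar> \<le> u\<^sup>2 + v\<^sup>2\<close>: both squared increments have the interval length as their
conditional mean, so the weight \<open>\<bar>\<xi> \<eta>\<bar>\<close> is all that remains.\<close>

lemma block_covariation_le:
  assumes W: "W \<in> brownian_motions M F" and V: "V \<in> brownian_motions M F"
    and ab: "0 \<le> a" "a \<le> b" and cd: "0 \<le> c" "c \<le> d"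
    and \<xi>: "bounded_at a \<xi>" and \<eta>: "bounded_at c \<eta>"
  shows "\<bar>expectation (\<lambda>\<omega>. (\<xi> \<omega> * (W b \<omega> - W a \<omega>)) * (\<eta> \<omega> * (V d \<omega> - V c \<omega>)))\<bar> \<le>
    (\<integral>z. \<bar>block \<xi> a b z\<bar> * \<bar>block \<eta> c d z\<bar> \<partial>(lborel \<Otimes>\<^sub>M M))"
proof -
  define p where "p = max a c"
  define q where "q = max p (min b d)"
  have pq: "0 \<le> p" "a \<le> p" "c \<le> p" "p \<le> q" using ab by (auto simp: p_def q_def)
  define \<zeta> where "\<zeta> \<omega> = \<bar>\<xi> \<omega> * \<eta> \<omega>\<bar>" for \<omega>
  have \<zeta>: "bounded_at p \<zeta>" unfolding \<zeta>_def[abs_def]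
    using bounded_at_abs[OF bounded_at_mult[OF bounded_at_mono[OF \<xi>] bounded_at_mono[OF \<eta>]]] ab cd pq by auto
  let ?W = "\<lambda>\<omega>. W q \<omega> - W p \<omega>" and ?V = "\<lambda>\<omega>. V q \<omega> - V p \<omega>"
  have sW: "square_integrable M ?W" and sV: "square_integrable M ?V"
    using W V pq by (auto intro: increment_square_integrable)
  have iW: "integrable M (\<lambda>\<omega>. \<zeta> \<omega> * (?W \<omega>)\<^sup>2)" and iV: "integrable M (\<lambda>\<omega>. \<zeta> \<omega> * (?V \<omega>)\<^sup>2)"
    using integrable_product[OF bounded_at_square_integrable[OF \<zeta> pq(1) sW] sW]
      integrable_product[OF bounded_at_square_integrable[OF \<zeta> pq(1) sV] sV]
    by (simp_all add: power2_eq_square mult.assoc)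
  have "\<bar>expectation (\<lambda>\<omega>. (\<xi> \<omega> * (W b \<omega> - W a \<omega>)) * (\<eta> \<omega> * (V d \<omega> - V c \<omega>)))\<bar>
      \<le> expectation (\<lambda>\<omega>. \<bar>(\<xi> \<omega> * \<eta> \<omega>) * (?W \<omega> * ?V \<omega>)\<bar>)"
    unfolding block_covariation[OF W V ab cd \<xi> \<eta> p_def q_def] by (rule integral_abs_bound)
  also have "\<dots> \<le> expectation (\<lambda>\<omega>. (\<zeta> \<omega> * (?W \<omega>)\<^sup>2 + \<zeta> \<omega> * (?V \<omega>)\<^sup>2) / 2)"
  proof (rule integral_mono')
    fix \<omega>
    have "2 * (\<bar>?W \<omega>\<bar> * \<bar>?V \<omega>\<bar>) \<le> (?W \<omega>)\<^sup>2 + (?V \<omega>)\<^sup>2"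
      using sum_squares_bound[of "\<bar>?W \<omega>\<bar>" "\<bar>?V \<omega>\<bar>"] by simp
    then have "\<zeta> \<omega> * (2 * (\<bar>?W \<omega>\<bar> * \<bar>?V \<omega>\<bar>)) \<le> \<zeta> \<omega> * ((?W \<omega>)\<^sup>2 + (?V \<omega>)\<^sup>2)"
      by (rule mult_left_mono) (simp add: \<zeta>_def)
    then show "\<bar>(\<xi> \<omega> * \<eta> \<omega>) * (?W \<omega> * ?V \<omega>)\<bar> \<le> (\<zeta> \<omega> * (?W \<omega>)\<^sup>2 + \<zeta> \<omega> * (?V \<omega>)\<^sup>2) / 2"
      unfolding distrib_left by (simp add: \<zeta>_def abs_mult)
  qed (use iW iV in \<open>auto simp: \<zeta>_def\<close>)
  also have "\<dots> = expectation \<zeta> * (q - p)"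
    using weighted_increment_variance[OF W pq(1,4) \<zeta>] weighted_increment_variance[OF V pq(1,4) \<zeta>] iW iV
    by simp
  also have "\<dots> = (\<integral>z. block \<zeta> p q z \<partial>(lborel \<Otimes>\<^sub>M M))" by (simp add: block_integral(2)[OF \<zeta> pq(1,4)])
  also have "block \<zeta> p q = (\<lambda>z. \<bar>block \<xi> a b z\<bar> * \<bar>block \<eta> c d z\<bar>)"
    unfolding abs_mult[symmetric] block_mult p_def[symmetric] q_def[symmetric]
    by (auto simp: block_def \<zeta>_def abs_mult)
  finally show ?thesis .
qed

end

section \<open>Integrals of simple integrands\<close>

context filtered_prob_space
begin

text \<open>Pairs of an integrand that is a finite sum of blocks, none starting before \<open>c\<close>, and of its integral
against \<open>W\<close>. Keeping both components in one relation avoids choosing a representation of the integrand. The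
bound \<open>c\<close> matters for multiplication by \<open>F c\<close>-measurable coefficients.\<close>

inductive simple_ito ::
    "(real \<Rightarrow> 'a \<Rightarrow> real) \<Rightarrow> real \<Rightarrow> (real \<times> 'a \<Rightarrow> real) \<Rightarrow> ('a \<Rightarrow> real) \<Rightarrow> bool"
  for W :: "real \<Rightarrow> 'a \<Rightarrow> real" and c :: real where
  zero: "simple_ito W c (\<lambda>_. 0) (\<lambda>_. 0)"
| add_block: "simple_ito W c G Z \<Longrightarrow> c \<le> a \<Longrightarrow> a \<le> b \<Longrightarrow> bounded_at a \<xi> \<Longrightarrow>
    simple_ito W c (\<lambda>z. block \<xi> a b z + G z) (\<lambda>\<omega>. \<xi> \<omega> * (W b \<omega> - W a \<omega>) + Z \<omega>)"

lemma simple_ito_cong: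
  "simple_ito W c G Z \<Longrightarrow> G = G' \<Longrightarrow> Z = Z' \<Longrightarrow> simple_ito W c G' Z'"
  by simp

lemma simple_ito_mono: "simple_ito W c G Z \<Longrightarrow> c' \<le> c \<Longrightarrow> simple_ito W c' G Z"
  by (induction rule: simple_ito.induct) (auto intro: simple_ito.intros)

lemma simple_ito_square_integrable:
  assumes "simple_ito W c G Z" "W \<in> brownian_motions M F" "0 \<le> c"
  shows "square_integrable (lborel \<Otimes>\<^sub>M M) G \<and> square_integrable M Z"
  using assms
  by (induction rule: simple_ito.induct)
    (auto intro!: square_integrable_zero square_integrable_add block_square_integrable
      bounded_at_square_integrable increment_square_integrable)

lemma simple_ito_add:
  assumes "simple_ito W c G Z" "simple_ito W c G' Z'"
  shows "simple_ito W c (\<lambda>z. G z + G' z) (\<lambda>\<omega>. Z \<omega> + Z' \<omega>)"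
  using assms(1)
proof (induction rule: simple_ito.induct)
  case zero then show ?case using assms(2) by simp
next
  case (add_block G Z a b \<xi>)
  from simple_ito.add_block[OF add_block.IH add_block.hyps(2-4)] show ?case
    by (simp add: add.assoc)
qed

text \<open>The product of the coefficients is still known at the start of each block, because no block starts
before \<open>c\<close>.\<close>

lemma simple_ito_scale:
  assumes "simple_ito W c G Z" "bounded_at c \<eta>" "0 \<le> c"
  shows "simple_ito W c (\<lambda>z. \<eta> (snd z) * G z) (\<lambda>\<omega>. \<eta> \<omega> * Z \<omega>)"
  using assms(1)
proof (induction rule: simple_ito.induct)
  case zero then show ?case using simple_ito.zero by simp
next
  case (add_block G Z a b \<xi>)
  have "bounded_at a (\<lambda>\<omega>. \<eta> \<omega> * \<xi> \<omega>)"
    using add_block.hyps assms by (intro bounded_at_mult bounded_at_mono[OF assms(2)]) auto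
  from simple_ito.add_block[OF add_block.IH add_block.hyps(2,3) this] show ?case
    by (rule simple_ito_cong) (auto simp: block_def algebra_simps)
qed

lemma simple_ito_mean:
  assumes "simple_ito W c G Z" "W \<in> brownian_motions M F" "0 \<le> c"
  shows "expectation Z = 0"
  using assms(1)
proof (induction rule: simple_ito.induct)
  case zero then show ?case by simp
next
  case (add_block G Z a b \<xi>)
  have ab: "0 \<le> a" "a \<le> b" using add_block assms by auto
  have one: "square_integrable M (\<lambda>_. 1)" by (rule square_integrable_const[OF finite_measure_axioms])
  have "integrable M (\<lambda>\<omega>. \<xi> \<omega> * (W b \<omega> - W a \<omega>))"
    using integrable_product[OF bounded_at_square_integrable[OF add_block.hyps(4) ab(1)
      increment_square_integrable[OF assms(2) ab]] one] by simp
  moreover have "integrable M Z"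
    using integrable_product[OF _ one] simple_ito_square_integrable[OF add_block.hyps(1) assms(2,3)] by simp
  moreover have "expectation (\<lambda>\<omega>. \<xi> \<omega> * (W b \<omega> - W a \<omega>)) = 0"
    using increment_orthogonal[OF assms(2) ab, of \<xi>] add_block.hyps(4)
      bounded_at_square_integrable[OF add_block.hyps(4) ab(1) one] by (simp add: bounded_at_def)
  ultimately show ?case using add_block.IH by simp
qed

text \<open>Both sides are bilinear and the blocks generate, so two inductions reduce the claim to two blocks.\<close>

lemma simple_ito_isometry:
  assumes G: "simple_ito W c G Z" and G': "simple_ito W c G' Z'"
    and W: "W \<in> brownian_motions M F" "0 \<le> c"
  shows "expectation (\<lambda>\<omega>. Z \<omega> * Z' \<omega>) = (\<integral>z. G z * G' z \<partial>(lborel \<Otimes>\<^sub>M M))"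
  using G
proof (induction rule: simple_ito.induct)
  case zero then show ?case by simp
next
  case (add_block G Z a b \<xi>)
  note sG = simple_ito_square_integrable[OF add_block.hyps(1) W]
  have ab: "0 \<le> a" "a \<le> b" using add_block W by auto
  have sb: "square_integrable (lborel \<Otimes>\<^sub>M M) (block \<xi> a b)"
    "square_integrable M (\<lambda>\<omega>. \<xi> \<omega> * (W b \<omega> - W a \<omega>))"
    using add_block.hyps ab W
    by (auto intro!: block_square_integrable bounded_at_square_integrable increment_square_integrable)
  have blk: "expectation (\<lambda>\<omega>. \<xi> \<omega> * (W b \<omega> - W a \<omega>) * Z' \<omega>) =
    (\<integral>z. block \<xi> a b z * G' z \<partial>(lborel \<Otimes>\<^sub>M M))"
    using G'
  proof (induction rule: simple_ito.induct)
    case zero then show ?case by simp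
  next
    case (add_block G1 Z1 c1 d \<eta>)
    note sG1 = simple_ito_square_integrable[OF add_block.hyps(1) W]
    have cd: "0 \<le> c1" "c1 \<le> d" using add_block W by auto
    have sb1: "square_integrable (lborel \<Otimes>\<^sub>M M) (block \<eta> c1 d)"
      "square_integrable M (\<lambda>\<omega>. \<eta> \<omega> * (W d \<omega> - W c1 \<omega>))"
      using add_block.hyps cd W
      by (auto intro!: block_square_integrable bounded_at_square_integrable increment_square_integrable)
    show ?case
      unfolding distrib_left
      using integrable_product[OF sb(1) sb1(1)] integrable_product[OF sb(2) sb1(2)]
        integrable_product[OF sb(1)] integrable_product[OF sb(2)] sG1
      by (subst (1 2) Bochner_Integration.integral_add)
        (auto simp: add_block.IH block_isometry[OF W(1) ab cd \<open>bounded_at a \<xi>\<close> add_block.hyps(4)])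
  qed
  note sG' = simple_ito_square_integrable[OF G' W]
  show ?case
    unfolding distrib_right
    using integrable_product[OF sb(1)] integrable_product[OF sb(2)] sG'
      integrable_product[of "lborel \<Otimes>\<^sub>M M" G G'] integrable_product[of M Z Z'] sG
    by (subst (1 2) Bochner_Integration.integral_add) (auto simp: add_block.IH blk)
qed

lemma simple_ito_restrict:
  assumes "simple_ito W 0 G Z" "0 \<le> u"
  shows "\<exists>Z'. simple_ito W u (\<lambda>z. indicator {u<..v} (fst z) * G z) Z'"
  using assms(1)
proof (induction rule: simple_ito.induct)
  case zero then show ?case using simple_ito.zero[of W u] by auto
next
  case (add_block G Z a b \<xi>)
  then obtain Z' where Z': "simple_ito W u (\<lambda>z. indicator {u<..v} (fst z) * G z) Z'" by auto
  define p q where "p = max u a" and "q = max p (min v b)"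
  have "bounded_at p \<xi>" using add_block.hyps by (auto simp: p_def intro: bounded_at_mono)
  then have "simple_ito W u (\<lambda>z. block \<xi> p q z + indicator {u<..v} (fst z) * G z)
     (\<lambda>\<omega>. \<xi> \<omega> * (W q \<omega> - W p \<omega>) + Z' \<omega>)"
    by (intro simple_ito.add_block[OF Z']) (auto simp: p_def q_def)
  moreover have "block \<xi> p q z = indicator {u<..v} (fst z) * block \<xi> a b z" for z
    by (auto simp: p_def q_def block_def split: split_indicator prod.splits)
  ultimately show ?case by (auto simp: distrib_left)
qed

end

section \<open>Limits of simple integrals\<close>

context filtered_prob_space
begin

text \<open>The closed graph of the simple integral. The integrand carries its own time horizon: the integral of
\<open>H\<close> up to time \<open>t\<close> is that of \<open>H\<close> cut off outside \<open>{0..t}\<close>.\<close>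

definition ito_limit :: "(real \<Rightarrow> 'a \<Rightarrow> real) \<Rightarrow> real \<Rightarrow> (real \<times> 'a \<Rightarrow> real) \<Rightarrow> ('a \<Rightarrow> real) \<Rightarrow> bool" where
  "ito_limit W c G Z \<longleftrightarrow> (\<exists>Gs Zs. (\<forall>k::nat. simple_ito W c (Gs k) (Zs k)) \<and>
     L2_lim (lborel \<Otimes>\<^sub>M M) Gs G \<and> L2_lim M Zs Z)"

lemma ito_limit_square_integrable:
  "ito_limit W c G Z \<Longrightarrow> square_integrable (lborel \<Otimes>\<^sub>M M) G" "ito_limit W c G Z \<Longrightarrow> square_integrable M Z"
  by (auto simp: ito_limit_def L2_lim_def)

lemma ito_limit_simple:
  assumes "simple_ito W c G Z" "W \<in> brownian_motions M F" "0 \<le> c"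
  shows "ito_limit W c G Z"
  unfolding ito_limit_def
  by (rule exI[of _ "\<lambda>_. G"], rule exI[of _ "\<lambda>_. Z"])
    (use assms simple_ito_square_integrable[OF assms] in \<open>auto intro: L2_lim_const\<close>)

lemma ito_limit_mono: "ito_limit W c G Z \<Longrightarrow> c' \<le> c \<Longrightarrow> ito_limit W c' G Z"
  unfolding ito_limit_def using simple_ito_mono by blast

lemma ito_limit_add:
  assumes "ito_limit W c G Z" "ito_limit W c G' Z'"
  shows "ito_limit W c (\<lambda>z. G z + G' z) (\<lambda>\<omega>. Z \<omega> + Z' \<omega>)"
proof -
  obtain Gs Zs Gs' Zs' where "\<forall>k::nat. simple_ito W c (Gs k) (Zs k)"
    "L2_lim (lborel \<Otimes>\<^sub>M M) Gs G" "L2_lim M Zs Z" "\<forall>k::nat. simple_ito W c (Gs' k) (Zs' k)"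
    "L2_lim (lborel \<Otimes>\<^sub>M M) Gs' G'" "L2_lim M Zs' Z'"
    using assms unfolding ito_limit_def by blast
  then show ?thesis unfolding ito_limit_def
    by (intro exI[of _ "\<lambda>k z. Gs k z + Gs' k z"] exI[of _ "\<lambda>k \<omega>. Zs k \<omega> + Zs' k \<omega>"])
      (auto intro: simple_ito_add L2_lim_add)
qed

lemma ito_limit_scale:
  assumes "ito_limit W c G Z" "bounded_at c \<eta>" "0 \<le> c"
  shows "ito_limit W c (\<lambda>z. \<eta> (snd z) * G z) (\<lambda>\<omega>. \<eta> \<omega> * Z \<omega>)"
proof -
  obtain Gs Zs where 1: "\<And>k::nat. simple_ito W c (Gs k) (Zs k)"
    and 2: "L2_lim (lborel \<Otimes>\<^sub>M M) Gs G" "L2_lim M Zs Z"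
    using assms unfolding ito_limit_def by blast
  obtain C where C: "\<And>\<omega>. \<omega> \<in> space M \<Longrightarrow> \<bar>\<eta> \<omega>\<bar> \<le> C" using assms by (auto simp: bounded_at_def)
  have \<eta>[measurable]: "\<eta> \<in> borel_measurable M"
    using assms by (auto simp: bounded_at_def intro: F_measurable)
  have "L2_lim (lborel \<Otimes>\<^sub>M M) (\<lambda>k z. \<eta> (snd z) * Gs k z) (\<lambda>z. \<eta> (snd z) * G z)"
    by (rule L2_lim_bounded_mult[OF 2(1)]) (use C in \<open>auto simp: space_pair_measure\<close>)
  moreover have "L2_lim M (\<lambda>k z. \<eta> z * Zs k z) (\<lambda>z. \<eta> z * Z z)"
    by (rule L2_lim_bounded_mult[OF 2(2)]) (use C in auto)
  ultimately show ?thesis unfolding ito_limit_def using simple_ito_scale[OF 1 assms(2,3)]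
    by (intro exI[of _ "\<lambda>k z. \<eta> (snd z) * Gs k z"] exI[of _ "\<lambda>k \<omega>. \<eta> \<omega> * Zs k \<omega>"]) auto
qed

lemma ito_limit_diff:
  assumes "ito_limit W c G Z" "ito_limit W c G' Z'" "0 \<le> c"
  shows "ito_limit W c (\<lambda>z. G z - G' z) (\<lambda>\<omega>. Z \<omega> - Z' \<omega>)"
  using ito_limit_add[OF assms(1) ito_limit_scale[OF assms(2) bounded_at_const[of _ "-1"] assms(3)]] by simp

lemma ito_limit_isometry:
  assumes "ito_limit W c G Z" "ito_limit W c G' Z'" "W \<in> brownian_motions M F" "0 \<le> c"
  shows "expectation (\<lambda>\<omega>. Z \<omega> * Z' \<omega>) = (\<integral>z. G z * G' z \<partial>(lborel \<Otimes>\<^sub>M M))"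
proof -
  obtain Gs Zs Gs' Zs' where s: "\<And>k::nat. simple_ito W c (Gs k) (Zs k)"
      "\<And>k::nat. simple_ito W c (Gs' k) (Zs' k)"
    and l: "L2_lim (lborel \<Otimes>\<^sub>M M) Gs G" "L2_lim M Zs Z"
      "L2_lim (lborel \<Otimes>\<^sub>M M) Gs' G'" "L2_lim M Zs' Z'"
    using assms unfolding ito_limit_def by blast
  show ?thesis
    using L2_lim_integral_mult[OF l(2,4)] L2_lim_integral_mult[OF l(1,3)]
    unfolding simple_ito_isometry[OF s assms(3,4)] by (rule LIMSEQ_unique)
qed

lemma ito_limit_mean:
  assumes "ito_limit W c G Z" "W \<in> brownian_motions M F" "0 \<le> c"
  shows "expectation Z = 0"
proof -
  obtain Gs Zs where s: "\<And>k::nat. simple_ito W c (Gs k) (Zs k)" and l: "L2_lim M Zs Z"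
    using assms unfolding ito_limit_def by blast
  have "(\<lambda>k. expectation (\<lambda>\<omega>. Zs k \<omega> * 1)) \<longlonglongrightarrow> expectation (\<lambda>\<omega>. Z \<omega> * 1)"
    by (rule L2_lim_integral_mult[OF l L2_lim_const[OF square_integrable_const[OF finite_measure_axioms]]])
  then show ?thesis
    using simple_ito_mean[OF s assms(2,3)] by (simp add: LIMSEQ_const_iff)
qed

text \<open>The isometry makes the integral independent of the approximation: any simple integrands that
approach \<open>G\<close> have integrals that approach \<open>Z\<close>. The limit is known with some approximation by blocks that may
start anywhere, and it may then be approached by blocks that start after \<open>c\<close>.\<close>

lemma ito_limit_L2_lim:
  assumes G: "ito_limit W 0 G Z" and W: "W \<in> brownian_motions M F" and c: "0 \<le> c"
    and s: "\<And>k. simple_ito W c (Gs k) (Zs k)" and l: "L2_lim (lborel \<Otimes>\<^sub>M M) Gs G"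
  shows "L2_lim M Zs Z"
proof -
  have ito: "ito_limit W 0 (\<lambda>z. Gs k z - G z) (\<lambda>\<omega>. Zs k \<omega> - Z \<omega>)" for k
    by (rule ito_limit_diff[OF ito_limit_mono[OF ito_limit_simple[OF s W c] c] G]) simp
  have "expectation (\<lambda>\<omega>. (Zs k \<omega> - Z \<omega>)\<^sup>2) = (\<integral>z. (Gs k z - G z)\<^sup>2 \<partial>(lborel \<Otimes>\<^sub>M M))" for k
    using ito_limit_isometry[OF ito[of k] ito[of k] W] by (simp add: power2_eq_square)
  then show ?thesis
    using l G s simple_ito_square_integrable[OF s W c] by (simp add: L2_lim_def ito_limit_square_integrable)
qed

text \<open>An integral over \<open>{u<..v}\<close> can be approximated by blocks that start after \<open>u\<close>: cut the approximations
of \<open>G\<close> down to that interval. This is what allows multiplication by an \<open>F u\<close>-measurable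
factor afterwards.\<close>

lemma ito_limit_restart:
  assumes G: "ito_limit W 0 (\<lambda>z. indicator {u<..v} (fst z) * G z) Z" and G': "ito_limit W 0 G Z'"
    and W: "W \<in> brownian_motions M F" and u: "0 \<le> u"
  shows "ito_limit W u (\<lambda>z. indicator {u<..v} (fst z) * G z) Z"
proof -
  obtain Gs Zs where 1: "\<And>k::nat. simple_ito W 0 (Gs k) (Zs k)"
    and 2: "L2_lim (lborel \<Otimes>\<^sub>M M) Gs G"
    using G' unfolding ito_limit_def by blast
  obtain Zs' where 3: "\<And>k. simple_ito W u (\<lambda>z. indicator {u<..v} (fst z) * Gs k z) (Zs' k)"
    using simple_ito_restrict[OF 1 u] by metis
  have "L2_lim (lborel \<Otimes>\<^sub>M M) (\<lambda>k z. indicator {u<..v} (fst z) * Gs k z) (\<lambda>z. indicator {u<..v} (fst z) * G z)"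
    by (rule L2_lim_bounded_mult[OF 2, where C = 1]) (auto simp: indicator_def)
  with ito_limit_L2_lim[OF G W u 3 this] 3 show ?thesis
    unfolding ito_limit_def
    by (intro exI[of _ "\<lambda>k z. indicator {u<..v} (fst z) * Gs k z"] exI[of _ Zs']) auto
qed

end

section \<open>Approximation by elementary processes\<close>

context filtered_prob_space
begin

definition cut_off :: "real \<Rightarrow> (real \<Rightarrow> 'a \<Rightarrow> real) \<Rightarrow> real \<times> 'a \<Rightarrow> real" where
  "cut_off t H = (\<lambda>(s, \<omega>). indicator {0..t} s * H s \<omega>)"

text \<open>Progressive measurability is a statement about each strip \<open>{0..t} \<times> \<Omega>\<close>; clamping the time into
\<open>{0..t}\<close> extends it to the whole product space.\<close>

lemma cut_off_measurable:
  assumes "progressively_measurable F H" "0 \<le> t"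
  shows "cut_off t H \<in> borel_measurable (lborel \<Otimes>\<^sub>M M)"
proof -
  have H: "(\<lambda>(s, \<omega>). H s \<omega>) \<in> borel_measurable (restrict_space borel {0..t} \<Otimes>\<^sub>M F t)"
    using assms by (simp add: progressively_measurable_def)
  have id: "(\<lambda>\<omega>. \<omega>) \<in> measurable M (F t)"
    using subalgebra_filtration[OF assms(2)] by (auto simp: measurable_def subalgebra_def sets.Int_space_eq2)
  have "(\<lambda>z. max 0 (min t (fst z))) \<in> measurable (lborel \<Otimes>\<^sub>M M) (restrict_space borel {0..t})"
    by (rule measurable_restrict_space2) (use assms in auto)
  then have "(\<lambda>z. (max 0 (min t (fst z)), snd z)) \<in> measurable (lborel \<Otimes>\<^sub>M M) (restrict_space borel {0..t} \<Otimes>\<^sub>M F t)"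
    by (intro measurable_Pair measurable_compose[OF measurable_snd id]) auto
  from measurable_compose[OF this H]
  have "(\<lambda>z. H (max 0 (min t (fst z))) (snd z)) \<in> borel_measurable (lborel \<Otimes>\<^sub>M M)" by simp
  then have "(\<lambda>z. indicator {0..t} (fst z) * H (max 0 (min t (fst z))) (snd z)) \<in> borel_measurable (lborel \<Otimes>\<^sub>M M)"
    by measurable
  also have "(\<lambda>z. indicator {0..t} (fst z) * H (max 0 (min t (fst z))) (snd z)) = cut_off t H"
    by (auto simp: cut_off_def split: split_indicator)
  finally show ?thesis .
qed

lemma elementary_times_nonneg:
  assumes "elementary_integrand M F n \<tau> \<xi>" "i \<le> n"
  shows "0 \<le> \<tau> i"
  using assms(2)
proof (induction i)
  case (Suc i)
  then show ?case using assms(1) by (auto simp: elementary_integrand_def intro: order_trans)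
qed (use assms(1) in \<open>simp add: elementary_integrand_def\<close>)

text \<open>If \<open>t < \<tau> n\<close>, the coefficient \<open>\<xi> n\<close> is not known at time \<open>t\<close>, but then its interval has shrunk to
the empty one and the summand disappears.\<close>

lemma elementary_simple_ito:
  assumes "elementary_integrand M F n \<tau> \<xi>" "0 \<le> t"
  shows "simple_ito W 0 (cut_off t (elementary_process n \<tau> \<xi>)) (elementary_integral W n \<tau> \<xi> t)"
  using assms(1)
proof (induction n)
  case 0
  then show ?case using simple_ito.zero[of W 0]
    by (simp add: cut_off_def elementary_process_def[abs_def] elementary_integral_def[abs_def])
next
  case (Suc n)
  then have \<tau>: "0 \<le> \<tau> n" "\<tau> n \<le> \<tau> (Suc n)" and \<xi>: "bounded_at (\<tau> n) (\<xi> n)"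
    and IH: "simple_ito W 0 (cut_off t (elementary_process n \<tau> \<xi>)) (elementary_integral W n \<tau> \<xi> t)"
    using elementary_times_nonneg[OF Suc.prems, of n] by (auto simp: elementary_integrand_def bounded_at_def)
  define a b where "a = min (\<tau> n) t" and "b = min (\<tau> (Suc n)) t"
  have "indicator {0..t} s * indicator {\<tau> n<..\<tau> (Suc n)} s = (indicator {a<..b} s :: real)" for s
    using \<tau> assms(2) by (auto simp: a_def b_def split: split_indicator)
  then have ind: "indicator {0..t} s * (r * indicator {\<tau> n<..\<tau> (Suc n)} s) = r * (indicator {a<..b} s :: real)" for s r
    by (simp add: mult.left_commute)
  have P: "cut_off t (elementary_process (Suc n) \<tau> \<xi>) =
    (\<lambda>z. block (\<xi> n) a b z + cut_off t (elementary_process n \<tau> \<xi>) z)"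
    unfolding cut_off_def block_def elementary_process_def
    by (rule ext) (simp only: case_prod_beta sum.lessThan_Suc distrib_left ind add.commute)
  have I: "elementary_integral W (Suc n) \<tau> \<xi> t =
    (\<lambda>\<omega>. \<xi> n \<omega> * (W b \<omega> - W a \<omega>) + elementary_integral W n \<tau> \<xi> t \<omega>)"
    by (auto simp: elementary_integral_def a_def b_def)
  show ?case
  proof (cases "\<tau> n \<le> t")
    case True
    then show ?thesis unfolding P I
      using \<tau> \<xi> by (intro simple_ito.add_block[OF IH]) (auto simp: a_def b_def)
  next
    case False
    then have "a = b" using \<tau> by (auto simp: a_def b_def)
    then show ?thesis unfolding P I using IH by (simp add: block_def case_prod_unfold)
  qed
qed

lemma is_ito_integral_approx:
  assumes I: "is_ito_integral M F W H I" and H: "progressively_measurable F H"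
    and W: "W \<in> brownian_motions M F" and t: "0 \<le> t"
  obtains n \<tau> \<xi> where "\<And>k. elementary_integrand M F (n k) (\<tau> k) (\<xi> k)"
    "L2_lim (lborel \<Otimes>\<^sub>M M) (\<lambda>k. cut_off t (elementary_process (n k) (\<tau> k) (\<xi> k))) (cut_off t H)"
    "L2_lim M (\<lambda>k. elementary_integral W (n k) (\<tau> k) (\<xi> k) t) (I t)"
proof -
  obtain n \<tau> \<xi> where e: "\<And>k::nat. elementary_integrand M F (n k) (\<tau> k) (\<xi> k)"
    and p: "(\<lambda>k. \<integral>\<^sup>+\<omega>. (\<integral>\<^sup>+s\<in>{0..t}.
             ennreal ((elementary_process (n k) (\<tau> k) (\<xi> k) s \<omega> - H s \<omega>)\<^sup>2) \<partial>lborel) \<partial>M) \<longlonglongrightarrow> 0"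
    and i: "(\<lambda>k. \<integral>\<^sup>+\<omega>. ennreal ((elementary_integral W (n k) (\<tau> k) (\<xi> k) t \<omega> - I t \<omega>)\<^sup>2) \<partial>M)
          \<longlonglongrightarrow> 0"
    using I t unfolding is_ito_integral_def by blast
  note s = elementary_simple_ito[OF e t, of W]
  note sq = simple_ito_square_integrable[OF s W order_refl]
  note [measurable] = cut_off_measurable[OF H t] square_integrableD(1)[OF sq[THEN conjunct1]]
  have "(\<integral>\<^sup>+\<omega>. (\<integral>\<^sup>+s\<in>{0..t}. ennreal ((elementary_process (n k) (\<tau> k) (\<xi> k) s \<omega> - H s \<omega>)\<^sup>2) \<partial>lborel) \<partial>M)
     = (\<integral>\<^sup>+z. ennreal ((cut_off t (elementary_process (n k) (\<tau> k) (\<xi> k)) z - cut_off t H z)\<^sup>2) \<partial>(lborel \<Otimes>\<^sub>M M))" for k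
  proof -
    let ?E = "elementary_process (n k) (\<tau> k) (\<xi> k)"
    have m: "(\<lambda>z. ennreal ((cut_off t ?E z - cut_off t H z)\<^sup>2)) \<in> borel_measurable (lborel \<Otimes>\<^sub>M M)"
      by measurable
    show ?thesis
      by (subst PM.nn_integral_snd[OF m, symmetric])
        (auto simp: cut_off_def split: split_indicator intro!: nn_integral_cong)
  qed
  then have "L2_lim (lborel \<Otimes>\<^sub>M M) (\<lambda>k. cut_off t (elementary_process (n k) (\<tau> k) (\<xi> k))) (cut_off t H)"
    using p sq by (intro L2_lim_nn_integral) auto
  moreover have "I t \<in> borel_measurable M"
    using I t unfolding is_ito_integral_def adapted_def by (auto intro: F_measurable)
  then have "L2_lim M (\<lambda>k. elementary_integral W (n k) (\<tau> k) (\<xi> k) t) (I t)"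
    using i sq by (intro L2_lim_nn_integral) auto
  ultimately show thesis using e that by blast
qed

lemma is_ito_integral_ito_limit:
  assumes I: "is_ito_integral M F W H I" and H: "progressively_measurable F H"
    and W: "W \<in> brownian_motions M F" and t: "0 \<le> t"
  shows "ito_limit W 0 (cut_off t H) (I t)"
proof -
  obtain n \<tau> \<xi> where e: "\<And>k. elementary_integrand M F (n k) (\<tau> k) (\<xi> k)"
    and l: "L2_lim (lborel \<Otimes>\<^sub>M M) (\<lambda>k. cut_off t (elementary_process (n k) (\<tau> k) (\<xi> k))) (cut_off t H)"
    "L2_lim M (\<lambda>k. elementary_integral W (n k) (\<tau> k) (\<xi> k) t) (I t)"
    using is_ito_integral_approx[OF assms] by blast
  then show ?thesis
    unfolding ito_limit_def
    by (intro exI[of _ "\<lambda>k. cut_off t (elementary_process (n k) (\<tau> k) (\<xi> k))"]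
        exI[of _ "\<lambda>k. elementary_integral W (n k) (\<tau> k) (\<xi> k) t"] conjI allI)
      (auto intro: elementary_simple_ito[OF e t])
qed

end

section \<open>Covariation of integrals against two Brownian motions\<close>

text \<open>At a given time at most one interval of a partition is active, so the same index serves for all choices
of the coefficients.\<close>

lemma step_function_value:
  fixes \<tau> :: "nat \<Rightarrow> real"
  assumes mono: "\<And>i. i < n \<Longrightarrow> \<tau> i \<le> \<tau> (Suc i)"
  obtains (outside) "\<And>x :: nat \<Rightarrow> real. (\<Sum>i<n. x i * indicator {\<tau> i<..\<tau> (Suc i)} s) = 0"
    | (inside) j where "j < n" "\<tau> j < s" "s \<le> \<tau> (Suc j)"
      "\<And>x :: nat \<Rightarrow> real. (\<Sum>i<n. x i * indicator {\<tau> i<..\<tau> (Suc i)} s) = x j"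
proof -
  have "(\<forall>x :: nat \<Rightarrow> real. (\<Sum>i<n. x i * indicator {\<tau> i<..\<tau> (Suc i)} s) = 0) \<or>
    (\<exists>j<n. \<tau> j < s \<and> s \<le> \<tau> (Suc j) \<and>
      (\<forall>x :: nat \<Rightarrow> real. (\<Sum>i<n. x i * indicator {\<tau> i<..\<tau> (Suc i)} s) = x j))"
    using mono
  proof (induction n)
    case (Suc n)
    have le: "i < n \<Longrightarrow> \<tau> (Suc i) \<le> \<tau> n" for i
      using Suc.prems
    proof (induction n)
      case (Suc n) then show ?case by (metis less_Suc_eq order_refl order_trans)
    qed simp
    show ?case
    proof (cases "\<tau> n < s \<and> s \<le> \<tau> (Suc n)")
      case True
      then have "(\<Sum>i<n. x i * indicator {\<tau> i<..\<tau> (Suc i)} s) = 0" for x :: "nat \<Rightarrow> real"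
        using le by (intro sum.neutral) (force simp: indicator_def)
      then have "\<forall>x :: nat \<Rightarrow> real. (\<Sum>i<Suc n. x i * indicator {\<tau> i<..\<tau> (Suc i)} s) = x n"
        using True by simp
      then show ?thesis using True by blast
    next
      case False
      then have "indicator {\<tau> n<..\<tau> (Suc n)} s = (0::real)" by (auto simp: indicator_def)
      then show ?thesis using Suc.IH Suc.prems by (simp add: less_Suc_eq) blast
    qed
  qed simp
  then show thesis using that by blast
qed

lemma integral_double_sum:
  fixes f :: "'i \<Rightarrow> 'j \<Rightarrow> 'b \<Rightarrow> real"
  assumes "\<And>i j. i \<in> A \<Longrightarrow> j \<in> B \<Longrightarrow> integrable N (f i j)"
  shows "(\<integral>x. (\<Sum>i\<in>A. \<Sum>j\<in>B. f i j x) \<partial>N) = (\<Sum>i\<in>A. \<Sum>j\<in>B. \<integral>x. f i j x \<partial>N)"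
proof -
  have "(\<integral>x. (\<Sum>i\<in>A. \<Sum>j\<in>B. f i j x) \<partial>N) = (\<Sum>i\<in>A. \<integral>x. (\<Sum>j\<in>B. f i j x) \<partial>N)"
    by (rule Bochner_Integration.integral_sum) (use assms in auto)
  also have "\<dots> = (\<Sum>i\<in>A. \<Sum>j\<in>B. \<integral>x. f i j x \<partial>N)"
    by (intro sum.cong refl Bochner_Integration.integral_sum assms)
  finally show ?thesis .
qed

context filtered_prob_space
begin

text \<open>The intervals of an elementary integrand are disjoint, hence the absolute value can be taken
inside the sum. This fails for general sums of blocks, and it is the reason why the covariation
inequality is proved for elementary integrands.\<close>

lemma elementary_blocks:
  assumes e: "elementary_integrand M F n \<tau> \<xi>" and t: "0 \<le> t"
  obtains a b \<zeta> where
    "\<And>i. i < n \<Longrightarrow> 0 \<le> a i \<and> a i \<le> b i \<and> bounded_at (a i) (\<zeta> i)"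
    "\<And>W. elementary_integral W n \<tau> \<xi> t = (\<lambda>\<omega>. \<Sum>i<n. \<zeta> i \<omega> * (W (b i) \<omega> - W (a i) \<omega>))"
    "\<And>z. \<bar>cut_off t (elementary_process n \<tau> \<xi>) z\<bar> = (\<Sum>i<n. \<bar>block (\<zeta> i) (a i) (b i) z\<bar>)"
proof -
  have mono: "\<And>i. i < n \<Longrightarrow> \<tau> i \<le> \<tau> (Suc i)" using e by (simp add: elementary_integrand_def)
  note nonneg = elementary_times_nonneg[OF e]
  define a b where "a i = min (\<tau> i) t" and "b i = min (\<tau> (Suc i)) t" for i
  \<comment> \<open>A coefficient whose interval starts after \<open>t\<close> is not known at time \<open>a i = t\<close>; it can be dropped, as its interval becomes empty.\<close>
  define \<zeta> where "\<zeta> i = (if \<tau> i \<le> t then \<xi> i else (\<lambda>_. 0))" for i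
  show thesis
  proof
    show "0 \<le> a i \<and> a i \<le> b i \<and> bounded_at (a i) (\<zeta> i)" if "i < n" for i
      using that mono[of i] nonneg[of i] t e bounded_at_const[of _ 0]
      by (auto simp: a_def b_def \<zeta>_def elementary_integrand_def bounded_at_def)
    show "elementary_integral W n \<tau> \<xi> t = (\<lambda>\<omega>. \<Sum>i<n. \<zeta> i \<omega> * (W (b i) \<omega> - W (a i) \<omega>))" for W
      unfolding elementary_integral_def
      using mono by (intro ext sum.cong) (force simp: a_def b_def \<zeta>_def)+
    show "\<bar>cut_off t (elementary_process n \<tau> \<xi>) z\<bar> = (\<Sum>i<n. \<bar>block (\<zeta> i) (a i) (b i) z\<bar>)" for z
    proof -
      obtain s \<omega> where z: "z = (s, \<omega>)" by fastforce
      have "\<bar>elementary_process n \<tau> \<xi> s \<omega>\<bar> = (\<Sum>i<n. \<bar>\<xi> i \<omega>\<bar> * indicator {\<tau> i<..\<tau> (Suc i)} s)"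
        unfolding elementary_process_def
        by (rule step_function_value[of n \<tau> s, OF mono]) simp_all
      then have "\<bar>cut_off t (elementary_process n \<tau> \<xi>) z\<bar> =
          (\<Sum>i<n. indicator {0..t} s * (\<bar>\<xi> i \<omega>\<bar> * indicator {\<tau> i<..\<tau> (Suc i)} s))"
        unfolding z cut_off_def case_prod_conv abs_mult
        by (simp only: sum_distrib_left abs_of_nonneg indicator_pos_le)
      also have "\<dots> = (\<Sum>i<n. \<bar>block (\<zeta> i) (a i) (b i) z\<bar>)"
      proof (rule sum.cong[OF refl])
        fix i assume "i \<in> {..<n}"
        then show "indicator {0..t} s * (\<bar>\<xi> i \<omega>\<bar> * indicator {\<tau> i<..\<tau> (Suc i)} s) = \<bar>block (\<zeta> i) (a i) (b i) z\<bar>"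
          using nonneg[of i] by (auto simp: z block_def a_def b_def \<zeta>_def split: split_indicator)
      qed
      finally show ?thesis .
    qed
  qed
qed

lemma elementary_covariation_le:
  assumes W: "W \<in> brownian_motions M F" and V: "V \<in> brownian_motions M F" and t: "0 \<le> t"
    and e: "elementary_integrand M F n \<tau> \<xi>" and f: "elementary_integrand M F m \<sigma> \<eta>"
  shows "\<bar>expectation (\<lambda>\<omega>. elementary_integral W n \<tau> \<xi> t \<omega> * elementary_integral V m \<sigma> \<eta> t \<omega>)\<bar> \<le>
    (\<integral>z. \<bar>cut_off t (elementary_process n \<tau> \<xi>) z\<bar> * \<bar>cut_off t (elementary_process m \<sigma> \<eta>) z\<bar> \<partial>(lborel \<Otimes>\<^sub>M M))"
proof -
  obtain a b \<zeta> where i: "\<And>i. i < n \<Longrightarrow> 0 \<le> a i \<and> a i \<le> b i \<and> bounded_at (a i) (\<zeta> i)"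
    and I: "\<And>W. elementary_integral W n \<tau> \<xi> t = (\<lambda>\<omega>. \<Sum>i<n. \<zeta> i \<omega> * (W (b i) \<omega> - W (a i) \<omega>))"
    and P: "\<And>z. \<bar>cut_off t (elementary_process n \<tau> \<xi>) z\<bar> = (\<Sum>i<n. \<bar>block (\<zeta> i) (a i) (b i) z\<bar>)"
    by (rule elementary_blocks[OF e t]) blast
  obtain c d \<theta> where j: "\<And>j. j < m \<Longrightarrow> 0 \<le> c j \<and> c j \<le> d j \<and> bounded_at (c j) (\<theta> j)"
    and J: "\<And>W. elementary_integral W m \<sigma> \<eta> t = (\<lambda>\<omega>. \<Sum>j<m. \<theta> j \<omega> * (W (d j) \<omega> - W (c j) \<omega>))"
    and Q: "\<And>z. \<bar>cut_off t (elementary_process m \<sigma> \<eta>) z\<bar> = (\<Sum>j<m. \<bar>block (\<theta> j) (c j) (d j) z\<bar>)"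
    by (rule elementary_blocks[OF f t]) blast
  have int: "integrable M (\<lambda>\<omega>. (\<zeta> i \<omega> * (W (b i) \<omega> - W (a i) \<omega>)) * (\<theta> j \<omega> * (V (d j) \<omega> - V (c j) \<omega>)))"
    and int': "integrable (lborel \<Otimes>\<^sub>M M) (\<lambda>z. \<bar>block (\<zeta> i) (a i) (b i) z\<bar> * \<bar>block (\<theta> j) (c j) (d j) z\<bar>)"
    if "i < n" "j < m" for i j
    using i[OF that(1)] j[OF that(2)] W V
    by (auto intro!: integrable_product bounded_at_square_integrable increment_square_integrable
        square_integrable_abs block_square_integrable simp del: abs_mult)
  have "expectation (\<lambda>\<omega>. elementary_integral W n \<tau> \<xi> t \<omega> * elementary_integral V m \<sigma> \<eta> t \<omega>) =
    (\<Sum>i<n. \<Sum>j<m. expectation (\<lambda>\<omega>. (\<zeta> i \<omega> * (W (b i) \<omega> - W (a i) \<omega>)) * (\<theta> j \<omega> * (V (d j) \<omega> - V (c j) \<omega>))))"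
    unfolding I J sum_product
    by (rule integral_double_sum) (use int in auto)
  also have "\<bar>\<dots>\<bar> \<le> (\<Sum>i<n. \<Sum>j<m. \<integral>z. \<bar>block (\<zeta> i) (a i) (b i) z\<bar> * \<bar>block (\<theta> j) (c j) (d j) z\<bar> \<partial>(lborel \<Otimes>\<^sub>M M))"
    by (intro order_trans[OF sum_abs] sum_mono order_trans[OF sum_abs] block_covariation_le W V)
      (use i j in auto)
  also have "\<dots> = (\<integral>z. \<bar>cut_off t (elementary_process n \<tau> \<xi>) z\<bar> * \<bar>cut_off t (elementary_process m \<sigma> \<eta>) z\<bar> \<partial>(lborel \<Otimes>\<^sub>M M))"
    unfolding P Q sum_product
    by (rule integral_double_sum[symmetric]) (use int' in auto)
  finally show ?thesis .
qed

text \<open>Elementary integrands satisfy the bound block by block, and both sides are continuous in \<open>L\<^sup>2\<close>.\<close>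

lemma covariation_le:
  assumes W: "W \<in> brownian_motions M F" and V: "V \<in> brownian_motions M F" and t: "0 \<le> t"
    and H: "progressively_measurable F H" and J: "progressively_measurable F J"
    and X: "is_ito_integral M F W H X" and Y: "is_ito_integral M F V J Y"
  shows "\<bar>expectation (\<lambda>\<omega>. X t \<omega> * Y t \<omega>)\<bar> \<le> (\<integral>z. \<bar>cut_off t H z\<bar> * \<bar>cut_off t J z\<bar> \<partial>(lborel \<Otimes>\<^sub>M M))"
proof -
  obtain n \<tau> \<xi> where e: "\<And>k. elementary_integrand M F (n k) (\<tau> k) (\<xi> k)"
    and l: "L2_lim (lborel \<Otimes>\<^sub>M M) (\<lambda>k. cut_off t (elementary_process (n k) (\<tau> k) (\<xi> k))) (cut_off t H)"
    "L2_lim M (\<lambda>k. elementary_integral W (n k) (\<tau> k) (\<xi> k) t) (X t)"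
    using is_ito_integral_approx[OF X H W t] by blast
  obtain m \<sigma> \<eta> where f: "\<And>k. elementary_integrand M F (m k) (\<sigma> k) (\<eta> k)"
    and l': "L2_lim (lborel \<Otimes>\<^sub>M M) (\<lambda>k. cut_off t (elementary_process (m k) (\<sigma> k) (\<eta> k))) (cut_off t J)"
    "L2_lim M (\<lambda>k. elementary_integral V (m k) (\<sigma> k) (\<eta> k) t) (Y t)"
    using is_ito_integral_approx[OF Y J V t] by blast
  show ?thesis
    using tendsto_rabs[OF L2_lim_integral_mult[OF l(2) l'(2)]]
      L2_lim_integral_mult[OF L2_lim_abs[OF l(1)] L2_lim_abs[OF l'(1)]]
    by (rule LIMSEQ_le) (use elementary_covariation_le[OF W V t e f] in blast)
qed

end

section \<open>Covariation of integrals against the same Brownian motion\<close>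

context filtered_prob_space
begin

text \<open>The increment over \<open>{a<..b}\<close> as an integral whose approximating blocks start after \<open>a\<close>, so that it may
be multiplied by \<open>F a\<close>-measurable coefficients.\<close>

lemma is_ito_integral_increment:
  assumes V: "is_ito_integral M F B \<epsilon> V" and B: "B \<in> brownian_motions M F"
    and \<epsilon>: "progressively_measurable F \<epsilon>" and ab: "0 \<le> a" "a \<le> b"
  shows "ito_limit B a (\<lambda>z. indicator {a<..b} (fst z) * cut_off b \<epsilon> z) (\<lambda>\<omega>. V b \<omega> - V a \<omega>)"
proof (rule ito_limit_restart[OF _ _ B ab(1)])
  show b: "ito_limit B 0 (cut_off b \<epsilon>) (V b)" using is_ito_integral_ito_limit[OF V \<epsilon> B] ab by simp
  have "cut_off b \<epsilon> z - cut_off a \<epsilon> z = indicator {a<..b} (fst z) * cut_off b \<epsilon> z" for z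
    using ab by (auto simp: cut_off_def split: split_indicator prod.splits)
  then show "ito_limit B 0 (\<lambda>z. indicator {a<..b} (fst z) * cut_off b \<epsilon> z) (\<lambda>\<omega>. V b \<omega> - V a \<omega>)"
    using ito_limit_diff[OF b is_ito_integral_ito_limit[OF V \<epsilon> B ab(1)]] by simp
qed

text \<open>Associativity \<open>\<integral> G dV = \<integral> G \<epsilon> dB\<close> for \<open>V = \<integral> \<epsilon> dB\<close>: a block against \<open>V\<close> is a coefficient times an
increment of \<open>V\<close>, which is itself an integral against \<open>B\<close>.\<close>

lemma simple_ito_associative:
  assumes V: "is_ito_integral M F B \<epsilon> V" and B: "B \<in> brownian_motions M F"
    and \<epsilon>: "progressively_measurable F \<epsilon>" and G: "simple_ito V 0 G Z"
  shows "ito_limit B 0 (\<lambda>z. G z * \<epsilon> (fst z) (snd z)) Z"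
  using G
proof (induction rule: simple_ito.induct)
  case zero
  then show ?case using ito_limit_simple[OF simple_ito.zero B] by simp
next
  case (add_block G Z a b \<xi>)
  have "ito_limit B 0 (\<lambda>z. \<xi> (snd z) * (indicator {a<..b} (fst z) * cut_off b \<epsilon> z)) (\<lambda>\<omega>. \<xi> \<omega> * (V b \<omega> - V a \<omega>))"
    using ito_limit_mono[OF ito_limit_scale[OF is_ito_integral_increment[OF V B \<epsilon>]]] add_block.hyps by auto
  moreover have "\<xi> (snd z) * (indicator {a<..b} (fst z) * cut_off b \<epsilon> z) = block \<xi> a b z * \<epsilon> (fst z) (snd z)" for z
    using add_block.hyps by (auto simp: cut_off_def block_def split: split_indicator prod.splits)
  ultimately have "ito_limit B 0 (\<lambda>z. block \<xi> a b z * \<epsilon> (fst z) (snd z)) (\<lambda>\<omega>. \<xi> \<omega> * (V b \<omega> - V a \<omega>))"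
    by simp
  from ito_limit_add[OF this add_block.IH] show ?case by (simp add: distrib_right)
qed

text \<open>Approximating \<open>J\<close> by simple integrands and using associativity, the integral against \<open>V\<close> becomes one
against \<open>B\<close>, where the isometry applies.\<close>

lemma covariation_eq:
  assumes V: "is_ito_integral M F B \<epsilon> V" "V \<in> brownian_motions M F" and B: "B \<in> brownian_motions M F"
    and \<epsilon>: "progressively_measurable F \<epsilon>" "\<And>s \<omega>. \<bar>\<epsilon> s \<omega>\<bar> \<le> C" and t: "0 \<le> t"
    and H: "progressively_measurable F H" and J: "progressively_measurable F J"
    and X: "is_ito_integral M F B H X" and Y: "is_ito_integral M F V J Y"
  shows "expectation (\<lambda>\<omega>. X t \<omega> * Y t \<omega>) =
    (\<integral>z. cut_off t \<epsilon> z * cut_off t H z * cut_off t J z \<partial>(lborel \<Otimes>\<^sub>M M))"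
proof -
  obtain Gs Zs where s: "\<And>k::nat. simple_ito V 0 (Gs k) (Zs k)"
    and l: "L2_lim (lborel \<Otimes>\<^sub>M M) Gs (cut_off t J)" "L2_lim M Zs (Y t)"
    using is_ito_integral_ito_limit[OF Y J V(2) t] unfolding ito_limit_def by blast
  have X': "ito_limit B 0 (cut_off t H) (X t)" by (rule is_ito_integral_ito_limit[OF X H B t])
  have sq: "square_integrable (lborel \<Otimes>\<^sub>M M) (\<lambda>z. cut_off t \<epsilon> z * cut_off t H z)"
    using \<epsilon>(2) order_trans[OF abs_ge_zero \<epsilon>(2)]
    by (intro square_integrable_bounded_mult[where C = C] ito_limit_square_integrable(1)[OF X'] cut_off_measurable \<epsilon>(1) t)
      (auto simp: cut_off_def split: split_indicator)
  have "expectation (\<lambda>\<omega>. X t \<omega> * Zs k \<omega>) = (\<integral>z. cut_off t \<epsilon> z * cut_off t H z * Gs k z \<partial>(lborel \<Otimes>\<^sub>M M))" for k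
    unfolding ito_limit_isometry[OF X' simple_ito_associative[OF V(1) B \<epsilon>(1) s] B order_refl]
    by (intro Bochner_Integration.integral_cong) (auto simp: cut_off_def indicator_def)
  then show ?thesis
    using L2_lim_integral_mult[OF L2_lim_const[OF ito_limit_square_integrable(2)[OF X']] l(2)]
      L2_lim_integral_mult[OF L2_lim_const[OF sq] l(1)]
    by (auto intro: LIMSEQ_unique)
qed

end

section \<open>Integrals of random signs are Brownian motions\<close>

context filtered_prob_space
begin

lemma increment_char:
  assumes W: "W \<in> brownian_motions M F" "0 \<le> a" "a \<le> b"
  shows "expectation (\<lambda>\<omega>. iexp (u * (W b \<omega> - W a \<omega>))) = exp (- (u\<^sup>2 * (b - a)) / 2)"
proof (cases "a = b")
  case True then show ?thesis by (simp add: prob_space)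
next
  case False
  then have ab: "a < b" using W by simp
  define r where "r = sqrt (b - a)"
  have r: "0 < r" "r\<^sup>2 = b - a" using ab by (auto simp: r_def)
  have "distributed M lborel (\<lambda>\<omega>. (W b \<omega> - W a \<omega>) / r) std_normal_density"
    using increment_normal[OF W(1,2) ab] normal_standard_normal_convert[OF r(1), of "\<lambda>\<omega>. W b \<omega> - W a \<omega>" 0]
    by (simp add: r_def)
  then have d: "distr M borel (\<lambda>\<omega>. (W b \<omega> - W a \<omega>) / r) = std_normal_distribution"
    by (auto simp: distributed_def cong: distr_cong)
  have [measurable]: "(\<lambda>\<omega>. W b \<omega> - W a \<omega>) \<in> borel_measurable M" by (rule increment_measurable[OF W])
  have "expectation (\<lambda>\<omega>. iexp (u * (W b \<omega> - W a \<omega>))) = expectation (\<lambda>\<omega>. iexp ((u * r) * ((W b \<omega> - W a \<omega>) / r)))"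
    using r by simp
  also have "\<dots> = char (distr M borel (\<lambda>\<omega>. (W b \<omega> - W a \<omega>) / r)) (u * r)"
    unfolding char_def by (subst integral_distr) auto
  also have "\<dots> = exp (- (u\<^sup>2 * (b - a)) / 2)"
    unfolding d char_std_normal_distribution by (simp add: power_mult_distrib r(2))
  finally show ?thesis .
qed

text \<open>An increment of \<open>W\<close> is symmetric and independent of the past, so multiplying it by a sign known at its
start does not change its conditional characteristic function, and the factors of successive increments
multiply.\<close>

lemma signed_sum_char:
  assumes W: "W \<in> brownian_motions M F" and s: "0 \<le> s" "s \<le> \<rho> 0"
    and mono: "\<And>i. i < n \<Longrightarrow> \<rho> i \<le> \<rho> (Suc i)"
    and \<sigma>: "\<And>i. i < n \<Longrightarrow> \<sigma> i \<in> borel_measurable (F (\<rho> i))"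
      "\<And>i \<omega>. i < n \<Longrightarrow> \<sigma> i \<omega> = 1 \<or> \<sigma> i \<omega> = -1"
    and A: "A \<in> sets (F s)"
  shows "expectation (\<lambda>\<omega>. indicator A \<omega> * iexp (u * (\<Sum>i<n. \<sigma> i \<omega> * (W (\<rho> (Suc i)) \<omega> - W (\<rho> i) \<omega>)))) =
    exp (- (u\<^sup>2 * (\<rho> n - \<rho> 0)) / 2) * prob A"
proof -
  define S where "S n \<omega> = (\<Sum>i<n. \<sigma> i \<omega> * (W (\<rho> (Suc i)) \<omega> - W (\<rho> i) \<omega>))" for n \<omega>
  have "s \<le> \<rho> n \<and> S n \<in> borel_measurable (F (\<rho> n)) \<and>
    expectation (\<lambda>\<omega>. indicator A \<omega> * iexp (u * S n \<omega>)) = exp (- (u\<^sup>2 * (\<rho> n - \<rho> 0)) / 2) * prob A"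
    using mono \<sigma>
  proof (induction n)
    case 0
    have "A \<in> events" using A subalgebra_filtration[OF s(1)] by (auto simp: subalgebra_def)
    moreover have "(indicator A :: 'a \<Rightarrow> complex) = (\<lambda>\<omega>. complex_of_real (indicator A \<omega>))"
      by (auto simp: indicator_def)
    ultimately show ?case using s by (simp add: S_def[abs_def])
  next
    case (Suc n)
    define a b where "a = \<rho> n" and "b = \<rho> (Suc n)"
    from Suc have IH: "s \<le> a" "S n \<in> borel_measurable (F a)"
      "expectation (\<lambda>\<omega>. indicator A \<omega> * iexp (u * S n \<omega>)) = exp (- (u\<^sup>2 * (a - \<rho> 0)) / 2) * prob A"
      by (auto simp: a_def)
    have ab: "0 \<le> a" "a \<le> b" using IH(1) s Suc.prems(1)[of n] by (auto simp: a_def b_def)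
    have \<sigma>n: "\<sigma> n \<in> borel_measurable (F a)" "\<And>\<omega>. \<sigma> n \<omega> = 1 \<or> \<sigma> n \<omega> = -1"
      using Suc.prems by (auto simp: a_def)
    let ?D = "\<lambda>\<omega>. W b \<omega> - W a \<omega>"
    have Aa: "A \<in> sets (F a)" using A filtration_mono[OF s(1) IH(1)] by (auto simp: subalgebra_def)
    have S: "S (Suc n) = (\<lambda>\<omega>. S n \<omega> + \<sigma> n \<omega> * ?D \<omega>)" by (auto simp: S_def a_def b_def)
    have S_meas: "S (Suc n) \<in> borel_measurable (F b)"
      unfolding S
      using F_mono_measurable[OF IH(2) ab] F_mono_measurable[OF \<sigma>n(1) ab]
        increment_F_measurable[OF W ab order_refl]
      by measurable
    \<comment> \<open>Split by the value \<open>r\<close> of the sign, which is known at time \<open>a\<close>.\<close>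
    define \<Phi> :: "real \<Rightarrow> 'a \<Rightarrow> complex" where
      "\<Phi> r \<omega> = indicator {\<omega>. \<sigma> n \<omega> = r} \<omega> * (indicator A \<omega> * iexp (u * S n \<omega>))" for r \<omega>
    have \<Phi>m: "\<Phi> r \<in> borel_measurable (F a)" for r
    proof -
      note [measurable] = IH(2) \<sigma>n(1) Aa
      have [measurable]: "{\<omega> \<in> space (F a). \<sigma> n \<omega> = r} \<in> sets (F a)" by measurable
      have "(\<lambda>\<omega>. indicator {\<omega> \<in> space (F a). \<sigma> n \<omega> = r} \<omega> * (indicator A \<omega> * iexp (u * S n \<omega>)))
          \<in> borel_measurable (F a)"
        by measurable
      then show ?thesis
        by (rule measurable_cong[THEN iffD1, rotated]) (auto simp: \<Phi>_def indicator_def)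
    qed
    have \<Phi>i: "integrable M (\<Phi> r)" for r
      by (rule integrable_const_bound[where B = 1])
        (use F_measurable[OF \<Phi>m ab(1)] in \<open>auto simp: \<Phi>_def norm_mult indicator_def\<close>)
    have Dm: "?D \<in> borel_measurable M" by (rule increment_measurable[OF W ab])
    have em[measurable]: "(\<lambda>\<omega>. iexp (r * ?D \<omega>)) \<in> borel_measurable M" for r
      using Dm by measurable
    have ei: "integrable M (\<lambda>\<omega>. iexp (r * ?D \<omega>))" for r
      by (rule integrable_const_bound[where B = 1]) (rule AE_I2, simp, rule em)
    have prod: "expectation (\<lambda>\<omega>. \<Phi> r \<omega> * iexp (v * ?D \<omega>)) = expectation (\<Phi> r) * exp (- (v\<^sup>2 * (b - a)) / 2)" for r v
      using increment_product[OF W ab \<Phi>m \<Phi>i, of "\<lambda>x. iexp (v * x)"] ei increment_char[OF W ab] by simp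
    have pi: "integrable M (\<lambda>\<omega>. \<Phi> r \<omega> * iexp (v * ?D \<omega>))" for r v
    proof (rule integrable_const_bound[where B = 1])
      show "(\<lambda>\<omega>. \<Phi> r \<omega> * iexp (v * ?D \<omega>)) \<in> borel_measurable M"
        by (intro borel_measurable_times F_measurable[OF \<Phi>m ab(1)] em)
    qed (auto simp: \<Phi>_def norm_mult indicator_def)
    have "indicator A \<omega> * iexp (u * S (Suc n) \<omega>) = \<Phi> 1 \<omega> * iexp (u * ?D \<omega>) + \<Phi> (-1) \<omega> * iexp ((-u) * ?D \<omega>)" for \<omega>
    proof -
      have "iexp (u * S (Suc n) \<omega>) = iexp (u * S n \<omega>) * iexp (u * \<sigma> n \<omega> * ?D \<omega>)"
        unfolding exp_add[symmetric] S by (simp add: algebra_simps)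
      then show ?thesis using \<sigma>n(2)[of \<omega>] by (elim disjE) (simp_all add: \<Phi>_def)
    qed
    then have "expectation (\<lambda>\<omega>. indicator A \<omega> * iexp (u * S (Suc n) \<omega>)) =
      (expectation (\<Phi> 1) + expectation (\<Phi> (-1))) * exp (- (u\<^sup>2 * (b - a)) / 2)"
      using prod[of 1 u] prod[of "-1" "-u"] pi[of 1 u] pi[of "-1" "-u"] by (simp add: distrib_right)
    also have "expectation (\<Phi> 1) + expectation (\<Phi> (-1)) = expectation (\<lambda>\<omega>. \<Phi> 1 \<omega> + \<Phi> (-1) \<omega>)"
      using \<Phi>i by simp
    also have "(\<lambda>\<omega>. \<Phi> 1 \<omega> + \<Phi> (-1) \<omega>) = (\<lambda>\<omega>. indicator A \<omega> * iexp (u * S n \<omega>))"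
    proof
      show "\<Phi> 1 \<omega> + \<Phi> (-1) \<omega> = indicator A \<omega> * iexp (u * S n \<omega>)" for \<omega>
        using \<sigma>n(2)[of \<omega>] by (auto simp: \<Phi>_def)
    qed
    also note IH(3)
    also have "complex_of_real (exp (- (u\<^sup>2 * (a - \<rho> 0)) / 2) * prob A) * complex_of_real (exp (- (u\<^sup>2 * (b - a)) / 2))
      = complex_of_real (exp (- (u\<^sup>2 * (a - \<rho> 0)) / 2 + (- (u\<^sup>2 * (b - a)) / 2)) * prob A)"
      unfolding exp_add by simp
    also have "- (u\<^sup>2 * (a - \<rho> 0)) / 2 + (- (u\<^sup>2 * (b - a)) / 2) = - (u\<^sup>2 * (b - \<rho> 0)) / 2"
      by (simp add: field_simps)
    finally show ?case using S_meas IH(1) ab by (simp add: b_def)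
  qed
  then show ?thesis by (simp add: S_def)
qed

lemma norm_iexp_diff_le: "norm (iexp x - iexp y) \<le> \<bar>x - y\<bar>"
proof -
  have "iexp x - iexp y = iexp y * (iexp (x - y) - 1)"
    by (simp add: right_diff_distrib exp_add[symmetric])
  then have "norm (iexp x - iexp y) = norm (iexp (x - y) - 1)" by (simp add: norm_mult)
  also have "\<dots> \<le> \<bar>x - y\<bar>" using iexp_approx1[of "x - y" 0] by simp
  finally show ?thesis .
qed

lemma L2_lim_char:
  assumes l: "L2_lim M Zs Z" and A: "A \<in> events"
  shows "(\<lambda>k. expectation (\<lambda>\<omega>. indicator A \<omega> * iexp (u * Zs k \<omega>))) \<longlonglongrightarrow>
    expectation (\<lambda>\<omega>. indicator A \<omega> * iexp (u * Z \<omega>))"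
proof -
  note L = L2_limD[OF l]
  note [measurable] = square_integrableD(1)[OF L(1)] square_integrableD(1)[OF L(2)] A
  have int: "integrable M (\<lambda>\<omega>. indicator A \<omega> * iexp (u * f \<omega>))" if [measurable]: "f \<in> borel_measurable M" for f
    by (rule integrable_const_bound[where B = 1]) (auto simp: norm_mult indicator_def)
  have bound: "norm (expectation (\<lambda>\<omega>. indicator A \<omega> * iexp (u * Zs k \<omega>)) - expectation (\<lambda>\<omega>. indicator A \<omega> * iexp (u * Z \<omega>)))
      \<le> \<bar>u\<bar> * sqrt (expectation (\<lambda>\<omega>. (Zs k \<omega> - Z \<omega>)\<^sup>2))" for k
  proof -
    note D = square_integrable_abs[OF square_integrable_diff[OF L(1)[of k] L(2)]]
    note one = square_integrable_const[OF finite_measure_axioms, of 1]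
    have "expectation (\<lambda>\<omega>. indicator A \<omega> * iexp (u * Zs k \<omega>)) - expectation (\<lambda>\<omega>. indicator A \<omega> * iexp (u * Z \<omega>))
      = expectation (\<lambda>\<omega>. indicator A \<omega> * iexp (u * Zs k \<omega>) - indicator A \<omega> * iexp (u * Z \<omega>))"
      by (intro Bochner_Integration.integral_diff[symmetric] int) auto
    also have "norm \<dots> \<le> expectation (\<lambda>\<omega>. \<bar>u\<bar> * \<bar>Zs k \<omega> - Z \<omega>\<bar>)"
    proof (rule order_trans[OF integral_norm_bound integral_mono])
      show "integrable M (\<lambda>\<omega>. \<bar>u\<bar> * \<bar>Zs k \<omega> - Z \<omega>\<bar>)"
        using integrable_product[OF D one] by simp
      show "norm (indicator A \<omega> * iexp (u * Zs k \<omega>) - indicator A \<omega> * iexp (u * Z \<omega>)) \<le> \<bar>u\<bar> * \<bar>Zs k \<omega> - Z \<omega>\<bar>" for \<omega>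
        using norm_iexp_diff_le[of "u * Zs k \<omega>" "u * Z \<omega>"]
        by (auto simp: indicator_def abs_mult simp flip: right_diff_distrib)
    qed (intro Bochner_Integration.integrable_diff integrable_norm int; simp)
    also have "\<dots> \<le> \<bar>u\<bar> * sqrt (expectation (\<lambda>\<omega>. (Zs k \<omega> - Z \<omega>)\<^sup>2))"
      using Cauchy_Schwarz_integral[OF D one] by (simp add: prob_space mult_left_mono)
    finally show ?thesis .
  qed
  have "(\<lambda>k. \<bar>u\<bar> * sqrt (expectation (\<lambda>\<omega>. (Zs k \<omega> - Z \<omega>)\<^sup>2))) \<longlonglongrightarrow> \<bar>u\<bar> * sqrt 0"
    by (intro tendsto_intros L)
  then have "(\<lambda>k. \<bar>u\<bar> * sqrt (expectation (\<lambda>\<omega>. (Zs k \<omega> - Z \<omega>)\<^sup>2))) \<longlonglongrightarrow> 0" by simp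
  then have "(\<lambda>k. expectation (\<lambda>\<omega>. indicator A \<omega> * iexp (u * Zs k \<omega>)) - expectation (\<lambda>\<omega>. indicator A \<omega> * iexp (u * Z \<omega>))) \<longlonglongrightarrow> 0"
    by (rule Lim_null_comparison[rotated]) (use bound in auto)
  then show ?thesis by (simp add: LIM_zero_iff)
qed

lemma simple_ito_sum:
  fixes n :: nat
  assumes "\<And>i. i < n \<Longrightarrow> c \<le> a i \<and> a i \<le> b i \<and> bounded_at (a i) (\<xi> i)"
  shows "simple_ito W c (\<lambda>z. \<Sum>i<n. block (\<xi> i) (a i) (b i) z) (\<lambda>\<omega>. \<Sum>i<n. \<xi> i \<omega> * (W (b i) \<omega> - W (a i) \<omega>))"
  using assms
proof (induction n)
  case 0 then show ?case by (simp add: simple_ito.zero)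
next
  case (Suc n)
  have "simple_ito W c (\<lambda>z. block (\<xi> n) (a n) (b n) z + (\<Sum>i<n. block (\<xi> i) (a i) (b i) z))
     (\<lambda>\<omega>. \<xi> n \<omega> * (W (b n) \<omega> - W (a n) \<omega>) + (\<Sum>i<n. \<xi> i \<omega> * (W (b i) \<omega> - W (a i) \<omega>)))"
    using Suc by (intro simple_ito.add_block) auto
  then show ?case by (simp add: add.commute)
qed

text \<open>Replaces the coefficients of an elementary integrand by their signs and restricts it to \<open>{s<..t}\<close>. Where the
sign of a coefficient differs from \<open>\<epsilon>\<close> the error grows from at least 1 to 2, which explains the factor 2.
The exponent is expressed through \<open>\<integral> G\<^sup>2\<close>, the total length of the remaining intervals, because in
this form its limit is a convergence of norms; the partition may fail to cover \<open>{s<..t}\<close>.\<close>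

lemma signed_approximation:
  assumes e: "elementary_integrand M F n \<tau> \<xi>" and st: "0 \<le> s" "s \<le> t"
    and W: "W \<in> brownian_motions M F"
    and \<epsilon>: "\<And>r \<omega>. \<epsilon> r \<omega> = 1 \<or> \<epsilon> r \<omega> = -1"
  obtains G Z where "simple_ito W s G Z"
    "\<And>z. \<bar>G z - indicator {s<..t} (fst z) * cut_off t \<epsilon> z\<bar>
      \<le> 2 * \<bar>cut_off t (elementary_process n \<tau> \<xi>) z - cut_off t \<epsilon> z\<bar>"
    "\<And>u A. A \<in> sets (F s) \<Longrightarrow> expectation (\<lambda>\<omega>. indicator A \<omega> * iexp (u * Z \<omega>)) =
      exp (- (u\<^sup>2 * (\<integral>z. G z * G z \<partial>(lborel \<Otimes>\<^sub>M M))) / 2) * prob A"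
proof -
  define \<rho> where "\<rho> i = max s (min (\<tau> i) t)" for i
  \<comment> \<open>The first condition makes the sign known at time \<open>\<rho> i\<close> even if \<open>t < \<tau> i\<close>, when the interval is empty.\<close>
  define \<sigma> where "\<sigma> i \<omega> = (if \<tau> i \<le> t \<and> \<xi> i \<omega> < 0 then - 1 else 1 :: real)" for i \<omega>
  define G where "G z = (\<Sum>i<n. block (\<sigma> i) (\<rho> i) (\<rho> (Suc i)) z)" for z
  define Z where "Z \<omega> = (\<Sum>i<n. \<sigma> i \<omega> * (W (\<rho> (Suc i)) \<omega> - W (\<rho> i) \<omega>))" for \<omega>
  have mono: "\<And>i. i < n \<Longrightarrow> \<tau> i \<le> \<tau> (Suc i)" using e by (simp add: elementary_integrand_def)
  note nonneg = elementary_times_nonneg[OF e]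
  have \<rho>: "s \<le> \<rho> i" for i by (simp add: \<rho>_def)
  have \<rho>_mono: "\<rho> i \<le> \<rho> (Suc i)" if "i < n" for i using mono[OF that] by (auto simp: \<rho>_def)
  have \<sigma>: "\<sigma> i \<in> borel_measurable (F (\<rho> i))" if "i < n" for i
  proof (cases "\<tau> i \<le> t")
    case True
    have "\<xi> i \<in> borel_measurable (F (\<tau> i))" using e that by (simp add: elementary_integrand_def)
    from F_mono_measurable[OF this, of "\<rho> i"] have [measurable]: "\<xi> i \<in> borel_measurable (F (\<rho> i))"
      using nonneg[of i] that True by (simp add: \<rho>_def)
    show ?thesis using True unfolding \<sigma>_def[abs_def] by simp
  qed (simp add: \<sigma>_def[abs_def])
  have \<sigma>_sign: "\<sigma> i \<omega> = 1 \<or> \<sigma> i \<omega> = -1" for i \<omega> by (simp add: \<sigma>_def)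
  have \<sigma>_bounded: "bounded_at (\<rho> i) (\<sigma> i)" if "i < n" for i
  proof -
    have "\<forall>\<omega>\<in>space M. \<bar>\<sigma> i \<omega>\<bar> \<le> 1" by (simp add: \<sigma>_def)
    then show ?thesis using \<sigma>[OF that] by (auto simp: bounded_at_def)
  qed
  have simple: "simple_ito W s G Z"
    unfolding G_def[abs_def] Z_def[abs_def]
    by (rule simple_ito_sum) (simp add: \<rho> \<rho>_mono \<sigma>_bounded)
  have close: "\<bar>G z - indicator {s<..t} (fst z) * cut_off t \<epsilon> z\<bar>
      \<le> 2 * \<bar>cut_off t (elementary_process n \<tau> \<xi>) z - cut_off t \<epsilon> z\<bar>" for z
  proof -
    obtain r \<omega> where z: "z = (r, \<omega>)" by fastforce
    have ind: "indicator {\<rho> i<..\<rho> (Suc i)} r = indicator {s<..t} r * (indicator {\<tau> i<..\<tau> (Suc i)} r :: real)" for i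
      by (auto simp: \<rho>_def split: split_indicator)
    have "G z = indicator {s<..t} r * (\<Sum>i<n. \<sigma> i \<omega> * indicator {\<tau> i<..\<tau> (Suc i)} r)"
      unfolding G_def z block_def case_prod_conv sum_distrib_left ind by (simp only: mult.left_commute)
    moreover have "\<bar>(\<Sum>i<n. \<sigma> i \<omega> * indicator {\<tau> i<..\<tau> (Suc i)} r) - \<epsilon> r \<omega>\<bar> \<le>
        2 * \<bar>elementary_process n \<tau> \<xi> r \<omega> - \<epsilon> r \<omega>\<bar>" if "r \<le> t"
      unfolding elementary_process_def
    proof (rule step_function_value[of n \<tau> r, OF mono])
      fix j assume "\<tau> j < r"
        and x: "\<And>x :: nat \<Rightarrow> real. (\<Sum>i<n. x i * indicator {\<tau> i<..\<tau> (Suc i)} r) = x j"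
      then show "\<bar>(\<Sum>i<n. \<sigma> i \<omega> * indicator {\<tau> i<..\<tau> (Suc i)} r) - \<epsilon> r \<omega>\<bar> \<le>
        2 * \<bar>(\<Sum>i<n. \<xi> i \<omega> * indicator {\<tau> i<..\<tau> (Suc i)} r) - \<epsilon> r \<omega>\<bar>"
        unfolding x using \<epsilon>[of r \<omega>] that by (auto simp: \<sigma>_def)
    qed (use \<epsilon>[of r \<omega>] in auto)
    ultimately show ?thesis using st
      by (auto simp: z cut_off_def split: split_indicator)
  qed
  have len: "(\<integral>z. G z * G z \<partial>(lborel \<Otimes>\<^sub>M M)) = \<rho> n - \<rho> 0"
  proof -
    have one: "bounded_at 0 (\<lambda>_. 1)" by (rule bounded_at_const)
    have "G z * G z = (\<Sum>i<n. block (\<lambda>_. 1) (\<rho> i) (\<rho> (Suc i)) z)" for z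
    proof -
      obtain r \<omega> where z: "z = (r, \<omega>)" by fastforce
      show ?thesis
        unfolding G_def z block_def case_prod_conv
      proof (rule step_function_value[of n \<rho> r, OF \<rho>_mono], assumption)
        fix j assume x: "\<And>x :: nat \<Rightarrow> real. (\<Sum>i<n. x i * indicator {\<rho> i<..\<rho> (Suc i)} r) = x j"
        show "(\<Sum>i<n. \<sigma> i \<omega> * indicator {\<rho> i<..\<rho> (Suc i)} r) * (\<Sum>i<n. \<sigma> i \<omega> * indicator {\<rho> i<..\<rho> (Suc i)} r)
          = (\<Sum>i<n. 1 * indicator {\<rho> i<..\<rho> (Suc i)} r)"
          unfolding x using \<sigma>_sign[of j \<omega>] by auto
      next
        assume x: "\<And>x :: nat \<Rightarrow> real. (\<Sum>i<n. x i * indicator {\<rho> i<..\<rho> (Suc i)} r) = 0"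
        show "(\<Sum>i<n. \<sigma> i \<omega> * indicator {\<rho> i<..\<rho> (Suc i)} r) * (\<Sum>i<n. \<sigma> i \<omega> * indicator {\<rho> i<..\<rho> (Suc i)} r)
          = (\<Sum>i<n. 1 * indicator {\<rho> i<..\<rho> (Suc i)} r)"
          unfolding x by simp
      qed
    qed
    then have "(\<integral>z. G z * G z \<partial>(lborel \<Otimes>\<^sub>M M)) =
        (\<integral>z. (\<Sum>i<n. block (\<lambda>_. 1) (\<rho> i) (\<rho> (Suc i)) z) \<partial>(lborel \<Otimes>\<^sub>M M))" by simp
    also have "\<dots> = (\<Sum>i<n. \<integral>z. block (\<lambda>_. 1) (\<rho> i) (\<rho> (Suc i)) z \<partial>(lborel \<Otimes>\<^sub>M M))"
      by (rule Bochner_Integration.integral_sum) (auto intro: block_integral(1)[OF one order_refl \<rho>_mono])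
    also have "\<dots> = (\<Sum>i<n. \<rho> (Suc i) - \<rho> i)"
      by (intro sum.cong refl) (simp add: block_integral(2)[OF one order_refl \<rho>_mono] prob_space)
    finally show ?thesis by (simp add: sum_lessThan_telescope)
  qed
  show thesis
  proof (rule that[OF simple close])
    show "expectation (\<lambda>\<omega>. indicator A \<omega> * iexp (u * Z \<omega>)) =
      exp (- (u\<^sup>2 * (\<integral>z. G z * G z \<partial>(lborel \<Otimes>\<^sub>M M))) / 2) * prob A" if "A \<in> sets (F s)" for u A
      unfolding len Z_def by (rule signed_sum_char[where \<rho> = \<rho> and \<sigma> = \<sigma> and n = n, OF W st(1) \<rho> \<rho>_mono \<sigma> \<sigma>_sign that])
  qed
qed

text \<open>Passes to the limit in the characteristic functions of the signed approximations. Their variances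
\<open>\<integral> G\<^sup>2\<close> converge to \<open>\<integral> \<epsilon>\<^sup>2 = t - s\<close>.\<close>

lemma sign_integral_char:
  assumes V: "is_ito_integral M F B \<epsilon> V" and B: "B \<in> brownian_motions M F"
    and \<epsilon>: "progressively_measurable F \<epsilon>" "\<And>r \<omega>. \<epsilon> r \<omega> = 1 \<or> \<epsilon> r \<omega> = -1"
    and st: "0 \<le> s" "s \<le> t" and A: "A \<in> sets (F s)"
  shows "expectation (\<lambda>\<omega>. indicator A \<omega> * iexp (u * (V t \<omega> - V s \<omega>))) = exp (- (u\<^sup>2 * (t - s)) / 2) * prob A"
proof -
  have t: "0 \<le> t" using st by simp
  define K where "K z = indicator {s<..t} (fst z) * cut_off t \<epsilon> z" for z
  have incr: "ito_limit B s K (\<lambda>\<omega>. V t \<omega> - V s \<omega>)"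
    unfolding K_def[abs_def] by (rule is_ito_integral_increment[OF V B \<epsilon>(1) st])
  obtain n \<tau> \<xi> where e: "\<And>k. elementary_integrand M F (n k) (\<tau> k) (\<xi> k)"
    and l: "L2_lim (lborel \<Otimes>\<^sub>M M) (\<lambda>k. cut_off t (elementary_process (n k) (\<tau> k) (\<xi> k))) (cut_off t \<epsilon>)"
    by (rule is_ito_integral_approx[OF V \<epsilon>(1) B t]) (rule that; assumption)
  define d where "d k z = cut_off t (elementary_process (n k) (\<tau> k) (\<xi> k)) z - cut_off t \<epsilon> z" for k z
  define P where "P k G Z \<longleftrightarrow> simple_ito B s G Z \<and> (\<forall>z. \<bar>G z - K z\<bar> \<le> 2 * \<bar>d k z\<bar>) \<and>
    (\<forall>u. expectation (\<lambda>\<omega>. indicator A \<omega> * iexp (u * Z \<omega>)) =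
      exp (- (u\<^sup>2 * (\<integral>z. G z * G z \<partial>(lborel \<Otimes>\<^sub>M M))) / 2) * prob A)" for k G Z
  have "\<exists>G Z. P k G Z" for k
    unfolding P_def
    by (rule signed_approximation[where \<epsilon> = \<epsilon>, OF e[of k] st B \<epsilon>(2)])
      (rule exI, rule exI, intro conjI allI, assumption, simp add: K_def d_def, simp add: A)
  then have "\<forall>k. \<exists>G. \<exists>Z. P k G Z" by blast
  from choice[OF this] obtain G where "\<forall>k. \<exists>Z. P k (G k) Z" by blast
  from choice[OF this] obtain Z where P: "\<And>k. P k (G k) (Z k)" by blast
  have simple: "\<And>k. simple_ito B s (G k) (Z k)"
    and close: "\<And>k z. \<bar>G k z - K z\<bar> \<le> 2 * \<bar>d k z\<bar>"
    and char: "\<And>k u. expectation (\<lambda>\<omega>. indicator A \<omega> * iexp (u * Z k \<omega>)) =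
      exp (- (u\<^sup>2 * (\<integral>z. G k z * G k z \<partial>(lborel \<Otimes>\<^sub>M M))) / 2) * prob A"
    using P unfolding P_def by blast+
  note sq = simple_ito_square_integrable[OF simple B st(1)]
  have lG: "L2_lim (lborel \<Otimes>\<^sub>M M) G K"
  proof (rule L2_lim_dominated[where h = "\<lambda>k z. 2\<^sup>2 * (d k z)\<^sup>2"])
    show "integrable (lborel \<Otimes>\<^sub>M M) (\<lambda>z. 2\<^sup>2 * (d k z)\<^sup>2)" for k
      using square_integrable_diff[OF L2_limD(1,2)[OF l], of k] by (simp add: square_integrable_def d_def)
    show "(\<lambda>k. \<integral>z. 2\<^sup>2 * (d k z)\<^sup>2 \<partial>(lborel \<Otimes>\<^sub>M M)) \<longlonglongrightarrow> 0"
      using tendsto_mult_left[OF L2_limD(3)[OF l], of "2\<^sup>2"] by (simp add: d_def)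
    show "(G k z - K z)\<^sup>2 \<le> 2\<^sup>2 * (d k z)\<^sup>2" for k z
      using power_mono[OF close[of k z], of 2] by (simp add: power_mult_distrib)
  qed (use sq ito_limit_square_integrable[OF incr] in auto)
  have lZ: "L2_lim M Z (\<lambda>\<omega>. V t \<omega> - V s \<omega>)"
    by (rule ito_limit_L2_lim[OF ito_limit_mono[OF incr st(1)] B st(1) simple lG])
  have "K z * K z = block (\<lambda>_. 1) s t z" for z
    using \<epsilon>(2)[of "fst z" "snd z"] st by (auto simp: K_def cut_off_def block_def split: split_indicator prod.splits)
  then have "(\<integral>z. K z * K z \<partial>(lborel \<Otimes>\<^sub>M M)) = t - s"
    using block_integral(2)[OF bounded_at_const order_refl st(2)] by (simp add: prob_space)
  with L2_lim_integral_mult[OF lG lG]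
  have lim: "(\<lambda>k. \<integral>z. G k z * G k z \<partial>(lborel \<Otimes>\<^sub>M M)) \<longlonglongrightarrow> t - s" by simp
  have Am: "A \<in> events" using A subalgebra_filtration[OF st(1)] by (auto simp: subalgebra_def)
  have "(\<lambda>k. complex_of_real (exp (- (u\<^sup>2 * (\<integral>z. G k z * G k z \<partial>(lborel \<Otimes>\<^sub>M M))) / 2) * prob A)) \<longlonglongrightarrow>
    complex_of_real (exp (- (u\<^sup>2 * (t - s)) / 2) * prob A)"
    by (intro tendsto_intros lim) simp
  with L2_lim_char[OF lZ Am, of u] show ?thesis
    unfolding char by (rule LIMSEQ_unique)
qed

text \<open>Under the conditional probability given \<open>A \<in> N\<close> the variable \<open>D\<close> has the Gaussian characteristic
function, hence by uniqueness the same Gaussian law for every \<open>A\<close>; that the conditional law does not depend on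
\<open>A\<close> is independence.\<close>

lemma normal_indep_of_char:
  assumes D[measurable]: "D \<in> borel_measurable M" and r: "0 < r"
    and sub: "subalgebra M N"
    and char: "\<And>u A. A \<in> sets N \<Longrightarrow> expectation (\<lambda>\<omega>. indicator A \<omega> * iexp (u * D \<omega>)) = exp (- (u\<^sup>2 * r\<^sup>2) / 2) * prob A"
  shows "distributed M lborel D (normal_density 0 r)"
    and "indep_set (sets N) (sets (vimage_algebra (space M) D borel))"
proof -
  define E where "E \<omega> = D \<omega> / r" for \<omega>
  have E[measurable]: "E \<in> borel_measurable M" unfolding E_def[abs_def] by measurable
  have Nsets: "A \<in> sets N \<Longrightarrow> A \<in> events" for A using sub by (auto simp: subalgebra_def)
  have law: "prob (A \<inter> (E -` S \<inter> space M)) = prob A * measure std_normal_distribution S"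
    if A: "A \<in> sets N" and S[measurable]: "S \<in> sets borel" for A S
  proof (cases "prob A = 0")
    case True
    have "prob (A \<inter> (E -` S \<inter> space M)) \<le> prob A" by (rule finite_measure_mono) (use Nsets[OF A] in auto)
    then show ?thesis using True by (simp add: measure_le_0_iff)
  next
    case False
    note Am[measurable] = Nsets[OF A]
    define Q where "Q = uniform_measure M A"
    have eA: "emeasure M A \<noteq> 0" "emeasure M A \<noteq> \<infinity>" using False by (auto simp: emeasure_eq_measure)
    interpret Q: prob_space Q unfolding Q_def by (rule prob_space_uniform_measure[OF eA])
    have Qd: "Q = density M (\<lambda>\<omega>. ennreal (indicator A \<omega> / prob A))"
      unfolding Q_def uniform_measure_def using False
      by (intro density_cong) (auto simp: emeasure_eq_measure indicator_def divide_ennreal ennreal_1[symmetric] zero_less_measure_iff simp del: ennreal_1 intro!: AE_I2)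
    have EQ[measurable]: "E \<in> borel_measurable Q" using E by (simp add: Q_def)
    have "char (distr Q borel E) u = char std_normal_distribution u" for u
    proof -
      have "char (distr Q borel E) u = (\<integral>\<omega>. iexp (u * E \<omega>) \<partial>Q)"
        unfolding char_def by (subst integral_distr) auto
      also have "\<dots> = expectation (\<lambda>\<omega>. (indicator A \<omega> / prob A) *\<^sub>R iexp (u * E \<omega>))"
        unfolding Qd by (subst integral_density) auto
      also have "\<dots> = expectation (\<lambda>\<omega>. complex_of_real (1 / prob A) * (indicator A \<omega> * iexp ((u / r) * D \<omega>)))"
        by (intro Bochner_Integration.integral_cong) (auto simp: E_def scaleR_conv_of_real split: split_indicator)
      also have "\<dots> = complex_of_real (1 / prob A) * (exp (- ((u / r)\<^sup>2 * r\<^sup>2) / 2) * prob A)"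
        unfolding integral_mult_right_zero char[OF A] by simp
      also have "\<dots> = exp (- (u\<^sup>2) / 2)"
        using False r by (simp add: power_divide)
      finally show ?thesis by (simp add: char_std_normal_distribution)
    qed
    then have "distr Q borel E = std_normal_distribution"
      by (intro Levy_uniqueness Q.real_distribution_distr real_dist_normal_dist EQ) auto
    then have "measure std_normal_distribution S = measure (distr Q borel E) S" by simp
    also have "\<dots> = measure Q (E -` S \<inter> space M)"
      by (subst measure_distr) (auto simp: Q_def)
    also have "\<dots> = prob (A \<inter> (E -` S \<inter> space M)) / prob A"
      unfolding Q_def by (rule measure_uniform_measure[OF eA]) simp
    finally show ?thesis using False by simp
  qed
  have top: "space M \<in> sets N" using sub sets.top[of N] by (simp add: subalgebra_def)
  have law1: "prob (E -` S \<inter> space M) = measure std_normal_distribution S" if "S \<in> sets borel" for S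
    using law[OF top that] by (simp add: prob_space Int_absorb1)
  interpret S: real_distribution std_normal_distribution by (rule real_dist_normal_dist)
  have "distr M borel E = std_normal_distribution"
  proof (rule measure_eqI)
    fix S assume "S \<in> sets (distr M borel E)"
    then show "emeasure (distr M borel E) S = emeasure std_normal_distribution S"
      using law1[of S] by (simp add: emeasure_distr emeasure_eq_measure S.emeasure_eq_measure)
  qed simp
  then have "distributed M lborel E std_normal_density"
    unfolding distributed_def by (auto cong: distr_cong)
  then show "distributed M lborel D (normal_density 0 r)"
    using normal_standard_normal_convert[OF r, of D 0] by (simp add: E_def[abs_def])
  show "indep_set (sets N) (sets (vimage_algebra (space M) D borel))"
    unfolding indep_sets2_eq
  proof (intro conjI ballI)
    show "sets N \<subseteq> events" using Nsets by auto
    have v: "sets (vimage_algebra (space M) D borel) = {D -` S \<inter> space M | S. S \<in> sets borel}"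
      by (rule sets_vimage_algebra2) auto
    show "sets (vimage_algebra (space M) D borel) \<subseteq> events" unfolding v by auto
    fix a b assume a: "a \<in> sets N" and "b \<in> sets (vimage_algebra (space M) D borel)"
    then obtain S where S: "S \<in> sets borel" "b = D -` S \<inter> space M" unfolding v by auto
    \<comment> \<open>The scaled variable \<open>E\<close> lies in this set exactly when \<open>D\<close> lies in \<open>S\<close>.\<close>
    define S' where "S' = (\<lambda>x. r * x) -` S"
    have "S' \<in> sets borel" unfolding S'_def
      using measurable_sets[of "\<lambda>x::real. r * x" borel borel S] S by simp
    moreover have "b = E -` S' \<inter> space M" using r by (auto simp: S S'_def E_def)
    ultimately show "prob (a \<inter> b) = prob a * prob b"
      using law[OF a] law1 by simp
  qed
qed

text \<open>The case of Levy's characterisation in which the continuous martingale is an integral of signs.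
Adaptedness and continuity are part of being an Ito integral; the law of the increments comes from
characteristic functions.\<close>

theorem sign_integral_brownian:
  assumes V: "is_ito_integral M F B \<epsilon> V" and B: "B \<in> brownian_motions M F"
    and \<epsilon>: "progressively_measurable F \<epsilon>" "\<And>r \<omega>. \<epsilon> r \<omega> = 1 \<or> \<epsilon> r \<omega> = -1"
  shows "V \<in> brownian_motions M F"
proof -
  have ad: "adapted F V" and co: "continuous_paths M V"
    using V by (auto simp: is_ito_integral_def)
  have Vm: "V t \<in> borel_measurable M" if "0 \<le> t" for t
    using ad that by (auto simp: adapted_def intro: F_measurable)
  have "AE \<omega> in M. V 0 \<omega> = 0"
  proof -
    \<comment> \<open>All elementary integrals vanish at time 0, because their partitions start at a nonnegative time.\<close>
    obtain n \<tau> \<xi> where e: "\<And>k. elementary_integrand M F (n k) (\<tau> k) (\<xi> k)"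
      and l: "L2_lim M (\<lambda>k. elementary_integral B (n k) (\<tau> k) (\<xi> k) 0) (V 0)"
      by (rule is_ito_integral_approx[OF V \<epsilon>(1) B order_refl]) (rule that; assumption)
    have "elementary_integral B (n k) (\<tau> k) (\<xi> k) 0 \<omega> = 0" for k \<omega>
      unfolding elementary_integral_def
      by (rule sum.neutral) (auto simp: min_absorb2 elementary_times_nonneg[OF e])
    then have "expectation (\<lambda>\<omega>. (V 0 \<omega>)\<^sup>2) = 0"
      using L2_limD(3)[OF l] by (simp add: LIMSEQ_const_iff)
    then have "AE \<omega> in M. (V 0 \<omega>)\<^sup>2 = 0"
      using L2_limD(2)[OF l] by (simp add: square_integrable_def integral_nonneg_eq_0_iff_AE)
    then show ?thesis by simp
  qed
  moreover have "distributed M lborel (\<lambda>\<omega>. V t \<omega> - V s \<omega>) (normal_density 0 (sqrt (t - s))) \<and>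
      indep_set (sets (F s)) (sets (vimage_algebra (space M) (\<lambda>\<omega>. V t \<omega> - V s \<omega>) borel))"
    if st: "0 \<le> s" "s < t" for s t
  proof -
    have r: "0 < sqrt (t - s)" "(sqrt (t - s))\<^sup>2 = t - s" using st by auto
    have m: "(\<lambda>\<omega>. V t \<omega> - V s \<omega>) \<in> borel_measurable M" using Vm st by auto
    note N = normal_indep_of_char[OF m r(1) subalgebra_filtration[OF st(1)], unfolded r(2)]
    show ?thesis using N sign_integral_char[OF V B \<epsilon> st(1)] st by simp
  qed
  ultimately show ?thesis using ad co by (auto simp: brownian_motions_def)
qed

end

section \<open>Comparison of the couplings\<close>

context filtered_prob_space
begin

text \<open>Everything on the right except the last term depends only on the integrands.\<close>

lemma expectation_square_difference:
  assumes X: "ito_limit W 0 G X" "W \<in> brownian_motions M F" and Y: "ito_limit V 0 K Y" "V \<in> brownian_motions M F"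
  shows "expectation (\<lambda>\<omega>. (r + (X \<omega> - Y \<omega>))\<^sup>2) =
    r\<^sup>2 + (\<integral>z. G z * G z \<partial>(lborel \<Otimes>\<^sub>M M)) + (\<integral>z. K z * K z \<partial>(lborel \<Otimes>\<^sub>M M))
      - 2 * expectation (\<lambda>\<omega>. X \<omega> * Y \<omega>)"
proof -
  note sX = ito_limit_square_integrable(2)[OF X(1)] and sY = ito_limit_square_integrable(2)[OF Y(1)]
  note one = square_integrable_const[OF finite_measure_axioms, of 1]
  have i: "integrable M X" "integrable M Y"
    using integrable_product[OF sX one] integrable_product[OF sY one] by simp_all
  have "expectation (\<lambda>\<omega>. (r + (X \<omega> - Y \<omega>))\<^sup>2) = expectation (\<lambda>\<omega>. r\<^sup>2 + 2 * r * X \<omega> - 2 * r * Y \<omega>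
      + X \<omega> * X \<omega> + Y \<omega> * Y \<omega> - 2 * (X \<omega> * Y \<omega>))"
    by (intro Bochner_Integration.integral_cong) (auto simp: power2_eq_square algebra_simps)
  also have "\<dots> = r\<^sup>2 + 2 * r * expectation X - 2 * r * expectation Y + expectation (\<lambda>\<omega>. X \<omega> * X \<omega>)
      + expectation (\<lambda>\<omega>. Y \<omega> * Y \<omega>) - 2 * expectation (\<lambda>\<omega>. X \<omega> * Y \<omega>)"
    using i integrable_product[OF sX sX] integrable_product[OF sY sY] integrable_product[OF sX sY]
    by (simp add: prob_space)
  finally show ?thesis
    using ito_limit_mean[OF X] ito_limit_mean[OF Y] ito_limit_isometry[OF X(1) X(1) X(2)] ito_limit_isometry[OF Y(1) Y(1) Y(2)]
    by simp
qed

lemma is_ito_integral_uminus: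
  assumes "is_ito_integral M F W H I"
  shows "is_ito_integral M F W (\<lambda>s \<omega>. - H s \<omega>) (\<lambda>t \<omega>. - I t \<omega>)"
proof -
  have P: "elementary_process n \<tau> (\<lambda>i \<omega>. - \<xi> i \<omega>) s \<omega> = - elementary_process n \<tau> \<xi> s \<omega>"
    and I: "elementary_integral W n \<tau> (\<lambda>i \<omega>. - \<xi> i \<omega>) t \<omega> = - elementary_integral W n \<tau> \<xi> t \<omega>"
    for n \<tau> \<xi> s t \<omega>
    by (simp_all add: elementary_process_def elementary_integral_def sum_negf)
  have sq: "(- a - - b)\<^sup>2 = (a - b)\<^sup>2" for a b :: real by (simp add: power2_commute)
  show ?thesis
    unfolding is_ito_integral_def
  proof (intro conjI allI impI)
    show "adapted F (\<lambda>t \<omega>. - I t \<omega>)" "continuous_paths M (\<lambda>t \<omega>. - I t \<omega>)"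
      using assms by (auto simp: is_ito_integral_def adapted_def continuous_paths_def intro: continuous_on_minus)
    fix t :: real assume "0 \<le> t"
    then obtain n \<tau> \<xi> where
      *: "\<And>k::nat. elementary_integrand M F (n k) (\<tau> k) (\<xi> k)"
        "(\<lambda>k. \<integral>\<^sup>+\<omega>. (\<integral>\<^sup>+s\<in>{0..t}.
             ennreal ((elementary_process (n k) (\<tau> k) (\<xi> k) s \<omega> - H s \<omega>)\<^sup>2) \<partial>lborel) \<partial>M) \<longlonglongrightarrow> 0"
        "(\<lambda>k. \<integral>\<^sup>+\<omega>. ennreal ((elementary_integral W (n k) (\<tau> k) (\<xi> k) t \<omega> - I t \<omega>)\<^sup>2) \<partial>M) \<longlonglongrightarrow> 0"
      using assms unfolding is_ito_integral_def by blast
    show "\<exists>n \<tau> \<xi>.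
        (\<forall>k. elementary_integrand M F (n k) (\<tau> k) (\<xi> k)) \<and>
        (\<lambda>k. \<integral>\<^sup>+\<omega>. (\<integral>\<^sup>+s\<in>{0..t}.
             ennreal ((elementary_process (n k) (\<tau> k) (\<xi> k) s \<omega> - - H s \<omega>)\<^sup>2) \<partial>lborel) \<partial>M)
          \<longlonglongrightarrow> 0 \<and>
        (\<lambda>k. \<integral>\<^sup>+\<omega>. ennreal ((elementary_integral W (n k) (\<tau> k) (\<xi> k) t \<omega> - - I t \<omega>)\<^sup>2) \<partial>M)
          \<longlonglongrightarrow> 0"
      using * by (intro exI[of _ n] exI[of _ \<tau>] exI[of _ "\<lambda>k i \<omega>. - \<xi> k i \<omega>"])
        (auto simp: P I sq elementary_integrand_def simp del: diff_minus_eq_add)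
  qed
qed

end

theorem proposition3p4:
  fixes M :: "'a measure" and F :: "real \<Rightarrow> 'a measure"
    and B H J X VI VII V :: "real \<Rightarrow> 'a \<Rightarrow> real"
    and Y :: "(real \<Rightarrow> 'a \<Rightarrow> real) \<Rightarrow> real \<Rightarrow> 'a \<Rightarrow> real"
    and x y c T :: real
  assumes "filtered_prob_space M F"
    and "B \<in> brownian_motions M F"
    and "progressively_measurable F H" and "progressively_measurable F J"
    and "\<And>t. t > 0 \<Longrightarrow>
      (\<integral>\<^sup>+\<omega>. (\<integral>\<^sup>+s\<in>{0..t}. ennreal ((H s \<omega>)\<^sup>2 + (J s \<omega>)\<^sup>2) \<partial>lborel) \<partial>M) < \<infinity>"
    and "is_ito_integral M F B H (\<lambda>t \<omega>. X t \<omega> - x)"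
    and "\<And>W. W \<in> brownian_motions M F \<Longrightarrow>
      is_ito_integral M F W J (\<lambda>t \<omega>. Y W t \<omega> - y)"
    and "c \<in> {1, -1}"
    and "is_ito_integral M F B (\<lambda>s \<omega>. sgn_conv c (H s \<omega> * J s \<omega>)) VI"
    and "VII = (\<lambda>t \<omega>. - VI t \<omega>)"
    and "T > 0"
    and "V \<in> brownian_motions M F"
  shows "prob_space.expectation M (\<lambda>\<omega>. (X T \<omega> - Y VI T \<omega>)\<^sup>2)
           \<le> prob_space.expectation M (\<lambda>\<omega>. (X T \<omega> - Y V T \<omega>)\<^sup>2) \<and>
         prob_space.expectation M (\<lambda>\<omega>. (X T \<omega> - Y V T \<omega>)\<^sup>2)
           \<le> prob_space.expectation M (\<lambda>\<omega>. (X T \<omega> - Y VII T \<omega>)\<^sup>2)"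
proof -
  interpret filtered_prob_space M F by fact
  note B = assms(2) and H = assms(3) and J = assms(4) and X = assms(6) and V = assms(12)
  define \<epsilon> where "\<epsilon> s \<omega> = sgn_conv c (H s \<omega> * J s \<omega>)" for s \<omega>
  have T: "0 \<le> T" using assms(11) by simp
  have sgn_conv[measurable]: "sgn_conv c \<in> borel_measurable borel"
    unfolding sgn_conv_def[abs_def] sgn_real_def by measurable
  have \<epsilon>: "progressively_measurable F \<epsilon>"
    unfolding progressively_measurable_def
  proof (intro allI impI)
    fix t :: real assume "0 \<le> t"
    then have [measurable]: "(\<lambda>z. H (fst z) (snd z)) \<in> borel_measurable (restrict_space borel {0..t} \<Otimes>\<^sub>M F t)"
      "(\<lambda>z. J (fst z) (snd z)) \<in> borel_measurable (restrict_space borel {0..t} \<Otimes>\<^sub>M F t)"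
      using H J by (simp_all add: progressively_measurable_def case_prod_beta')
    show "(\<lambda>(s, \<omega>). \<epsilon> s \<omega>) \<in> borel_measurable (restrict_space borel {0..t} \<Otimes>\<^sub>M F t)"
      unfolding \<epsilon>_def case_prod_beta' by measurable
  qed
  have n\<epsilon>: "progressively_measurable F (\<lambda>s \<omega>. - \<epsilon> s \<omega>)"
    using \<epsilon> by (simp add: progressively_measurable_def case_prod_beta')
  have \<epsilon>_sign: "\<epsilon> s \<omega> = 1 \<or> \<epsilon> s \<omega> = -1" for s \<omega>
    using assms(8) by (auto simp: \<epsilon>_def sgn_conv_def sgn_real_def)
  have VI: "is_ito_integral M F B \<epsilon> VI" using assms(9) by (simp add: \<epsilon>_def[abs_def])
  have VII: "is_ito_integral M F B (\<lambda>s \<omega>. - \<epsilon> s \<omega>) VII"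
    unfolding assms(10) by (rule is_ito_integral_uminus[OF VI])
  have VI_bm: "VI \<in> brownian_motions M F" by (rule sign_integral_brownian[OF VI B \<epsilon> \<epsilon>_sign])
  have VII_bm: "VII \<in> brownian_motions M F"
    by (rule sign_integral_brownian[OF VII B n\<epsilon>]) (use \<epsilon>_sign in force)
  have \<epsilon>_le: "\<bar>\<epsilon> s \<omega>\<bar> \<le> 1" "\<bar>- \<epsilon> s \<omega>\<bar> \<le> 1" for s \<omega> using \<epsilon>_sign[of s \<omega>] by auto
  define C where "C W = expectation (\<lambda>\<omega>. (X T \<omega> - x) * (Y W T \<omega> - y))" for W
  define A where "A = (\<integral>z. \<bar>cut_off T H z\<bar> * \<bar>cut_off T J z\<bar> \<partial>(lborel \<Otimes>\<^sub>M M))"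
  have bound: "\<bar>C V\<bar> \<le> A"
    unfolding C_def A_def by (rule covariation_le[OF B V T H J X assms(7)[OF V]])
  have sign: "cut_off T \<epsilon> z * cut_off T H z * cut_off T J z = \<bar>cut_off T H z\<bar> * \<bar>cut_off T J z\<bar>" for z
    by (auto simp: cut_off_def \<epsilon>_def sgn_conv_def abs_mult sgn_mult abs_sgn mult_ac split: prod.splits split_indicator)
  have CI: "C VI = A"
    unfolding C_def A_def
    using covariation_eq[OF VI VI_bm B \<epsilon> \<epsilon>_le(1) T H J X assms(7)[OF VI_bm]]
    by (simp add: sign)
  have CII: "C VII = - A"
  proof -
    have "cut_off T (\<lambda>s \<omega>. - \<epsilon> s \<omega>) z * cut_off T H z * cut_off T J z = - (\<bar>cut_off T H z\<bar> * \<bar>cut_off T J z\<bar>)" for z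
      unfolding sign[symmetric] by (simp add: cut_off_def split: prod.splits)
    then show ?thesis
      unfolding C_def A_def
      using covariation_eq[OF VII VII_bm B n\<epsilon> \<epsilon>_le(2) T H J X assms(7)[OF VII_bm]]
      by (simp only: Bochner_Integration.integral_minus)
  qed
  have expand: "expectation (\<lambda>\<omega>. (X T \<omega> - Y W T \<omega>)\<^sup>2) =
      (x - y)\<^sup>2 + (\<integral>z. cut_off T H z * cut_off T H z \<partial>(lborel \<Otimes>\<^sub>M M))
        + (\<integral>z. cut_off T J z * cut_off T J z \<partial>(lborel \<Otimes>\<^sub>M M)) - 2 * C W"
    if W: "W \<in> brownian_motions M F" for W
  proof -
    \<comment> \<open>Separate the initial values from the centred integrals.\<close>
    have "(\<lambda>\<omega>. (X T \<omega> - Y W T \<omega>)\<^sup>2) = (\<lambda>\<omega>. ((x - y) + ((X T \<omega> - x) - (Y W T \<omega> - y)))\<^sup>2)"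
      by (simp add: algebra_simps)
    then show ?thesis
      unfolding C_def
      using expectation_square_difference[OF is_ito_integral_ito_limit[OF X H B T] B
          is_ito_integral_ito_limit[OF assms(7)[OF W] J W T] W, of "x - y"]
      by simp
  qed
  show ?thesis
    unfolding expand[OF VI_bm] expand[OF VII_bm] expand[OF V] CI CII using bound by linarith
qed

end
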